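(* Let $q$ be a prime power, $n\ge 1$ and $r\ge 2$ integers, and let $V$ be an $r$-dimensional $\mathbb{F}_{q^n}$-vector space. Let $U$ be an $\mathbb{F}_q$-subspace of $V$ with $\dim_{\mathbb{F}_q}U=m$, $1\le m\le (r-1)n$, defining the $\mathbb{F}_q$-linear set $L_U$ of rank $m$ of $\mathrm{PG}(V,\mathbb{F}_{q^n})=\mathrm{PG}(r-1,q^n)$. Assume that $n\le q$ and that every point of $L_U$ has weight at least $w$, where $w\ge 2$ is an integer. Then there exists an integer $d$ with $d\ge w$ and $d\mid n$ such that $L_U=L_{U'}$, where $U'=\langle U\rangle_{\mathbb{F}_{q^d}}$ is the $\mathbb{F}_{q^d}$-span of $U$ in $V$.
   Context: For an $\mathbb{F}_q$-subspace $U$ of an $\mathbb{F}_{q^n}$-vector space $V$ with $\dim_{\mathbb{F}_q} U=m$, the $\mathbb{F}_q$-linear set of rank $m$ defined by $U$ is the set of points $L_U=\{\langle \mathbf{u}\rangle_{\mathbb{F}_{q^n}} : \mathbf{u}\in U\setminus\{\mathbf{0}\}\}$ of $\mathrm{PG}(V,\mathbb{F}_{q^n})$. The weight of a point $P=\langle \mathbf{v}\rangle_{\mathbb{F}_{q^n}}$ with respect to $L_U$ is $w_{L_U}(P)=\dim_{\mathbb{F}_q}(\langle \mathbf{v}\rangle_{\mathbb{F}_{q^n}}\cap U)$. *)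

theory Defs
  imports "HOL-Number_Theory.Prime_Powers" "HOL-Library.Cardinality"
begin

definition field_embedding :: "('a::field \<Rightarrow> 'k::field) \<Rightarrow> bool" where
  "field_embedding emb \<longleftrightarrow>
     emb 1 = 1 \<and> (\<forall>a b. emb (a + b) = emb a + emb b) \<and> (\<forall>a b. emb (a * b) = emb a * emb b)"

definition restrict_scalars ::
    "('a \<Rightarrow> 'k) \<Rightarrow> ('k \<Rightarrow> 'v \<Rightarrow> 'v) \<Rightarrow> 'a \<Rightarrow> 'v \<Rightarrow> 'v" where
  "restrict_scalars emb scale a v = scale (emb a) v"

lemma vector_space_restrict_scalars:
  assumes "vector_space scale" and "field_embedding emb"
  shows "vector_space (restrict_scalars emb scale)"
proof -
  interpret vector_space scale by (rule assms(1))
  show ?thesis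
    using assms(2)
    by unfold_locales
       (auto simp: restrict_scalars_def field_embedding_def scale_right_distrib scale_left_distrib)
qed

definition is_subfield :: "'k::field set \<Rightarrow> bool" where
  "is_subfield K \<longleftrightarrow>
     0 \<in> K \<and> 1 \<in> K \<and> (\<forall>x\<in>K. \<forall>y\<in>K. x - y \<in> K) \<and> (\<forall>x\<in>K. \<forall>y\<in>K. x * y \<in> K) \<and>
     (\<forall>x\<in>K. x \<noteq> 0 \<longrightarrow> inverse x \<in> K)"

text \<open>
  The library's span takes its coefficients from a whole type. This is the same set of linear
  combinations with the coefficients restricted to \<open>K\<close>.
\<close>

definition span_over ::
    "('k \<Rightarrow> 'v \<Rightarrow> 'v) \<Rightarrow> 'k set \<Rightarrow> 'v::ab_group_add set \<Rightarrow> 'v set" where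
  "span_over scale K S = {(\<Sum>v\<in>T. scale (c v) v) | T c. finite T \<and> T \<subseteq> S \<and> c ` T \<subseteq> K}"

lemma span_over_UNIV:
  assumes "module scale"
  shows "span_over scale UNIV S = module.span scale S"
  by (simp add: span_over_def module.span_explicit[OF assms])

text \<open>
  A point of the projective space of \<open>V\<close> is identified with the corresponding one-dimensional
  subspace of \<open>V\<close>, as a set of vectors.
\<close>

definition linear_set ::
    "('k::field \<Rightarrow> 'v \<Rightarrow> 'v) \<Rightarrow> 'v::ab_group_add set \<Rightarrow> 'v set set" where
  "linear_set scale U = {module.span scale {u} | u. u \<in> U - {0}}"

definition point_weight ::
    "('a::field \<Rightarrow> 'k::field) \<Rightarrow> ('k \<Rightarrow> 'v \<Rightarrow> 'v) \<Rightarrow> 'v::ab_group_add set \<Rightarrow> 'v set \<Rightarrow> nat" where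
  "point_weight emb scale U P = vector_space.dim (restrict_scalars emb scale) (P \<inter> U)"

end

theory Submission
  imports Defs "HOL-Library.Function_Algebras" "HOL-Computational_Algebra.Polynomial"
    "HOL-Computational_Algebra.Formal_Laurent_Series"
begin

text \<open>
  Write \<open>F\<close> and \<open>K\<close> for the fields with \<open>q\<close> and \<open>q ^ n\<close> elements. For a vector \<open>u\<close> let \<open>T\<^sub>u\<close> be the
  \<open>F\<close>-space of all \<open>\<alpha> \<in> K\<close> with \<open>\<alpha> u \<in> U\<close>; its dimension is the weight of the point of \<open>u\<close>, and it
  contains \<open>1\<close> when \<open>u \<in> U\<close>.

  The key step is a tangent argument. If \<open>u \<in> U\<close> has least weight, then the rank of \<open>\<alpha> \<mapsto> \<alpha> u\<close> modulo
  \<open>U\<close> does not change to first order along \<open>u + \<mu> v\<close> with \<open>v \<in> U\<close>, and differentiating a kernel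
  vector gives \<open>\<alpha> v \<in> U + K u\<close> for all \<open>\<alpha> \<in> T\<^sub>u\<close> and \<open>v \<in> U\<close>. So \<open>T\<^sub>u\<close> is contained in
  the field \<open>D\<close> of all scalars that map \<open>M = U + K u\<close> into itself. This \<open>D\<close> has degree \<open>d \<ge> w\<close>
  over \<open>F\<close>, and \<open>U' = D U\<close> is contained in \<open>M\<close>. If \<open>u\<close> has least
  weight with respect to \<open>U'\<close> too, the same argument shows that all \<open>\<alpha>\<close> with \<open>\<alpha> u \<in> U'\<close> are in \<open>D\<close>.
  Then \<open>U' = U + D u\<close>, and as \<open>u \<in> U\<close>, the quotient of \<open>U'\<close> by \<open>U\<close> has dimension less than \<open>d\<close>.
  For \<open>y \<in> U'\<close> the map \<open>\<delta> \<mapsto> \<delta> y\<close> from \<open>D\<close> to this quotient is therefore not injective: some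
  nonzero multiple of \<open>y\<close> is in \<open>U\<close>. So \<open>U\<close> and \<open>U'\<close> define the same points.

  The field \<open>F\<close> may be too small to contain a vector \<open>u\<close> of least weight with respect to both \<open>U\<close> and
  the spans of \<open>U\<close> over all subfields. The argument is therefore carried out after extending scalars
  to Laurent series over \<open>F\<close> and \<open>K\<close>, where a common generic vector exists
  (\<open>exists_simultaneously_generic\<close>). Two facts allow this. First, all weights remain at least \<open>w\<close>
  (\<open>weight_generic\<close>); this uses \<open>n \<le> q\<close> and a bound on the number of parameters at which the rank
  drops in a pencil of linear maps (\<open>pencil_degenerate_scalars\<close>). Second, a ring between the two
  Laurent series fields is spanned by the elements of \<open>K\<close> it contains
  (\<open>intermediate_ring_spanned_by_constants\<close>), so that \<open>D\<close> can be found inside \<open>K\<close>. The tangent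
  argument itself is \<open>tangent_at_generic\<close>.
\<close>

section \<open>Rank drop in pencils of linear maps\<close>

lemma (in vector_space) independent_Un:
  assumes "finite A" "independent A" "independent B"
    and "\<And>x. x \<in> span A \<Longrightarrow> x \<in> span B \<Longrightarrow> x = 0"
  shows "independent (A \<union> B)"
  using assms
proof (induction A)
  case (insert a A)
  have A: "independent A" and a: "a \<notin> span A"
    using insert.prems(1) insert.hyps by (auto simp: independent_insert)
  have "x = 0" if "x \<in> span A" "x \<in> span B" for x
    using insert.prems(3) that span_mono[of A "insert a A"] by blast
  then have IH: "independent (A \<union> B)"
    using insert.IH A insert.prems(2) by blast
  have "a \<notin> span (A \<union> B)"
  proof
    assume "a \<in> span (A \<union> B)"
    then obtain x y where xy: "a = x + y" "x \<in> span A" "y \<in> span B"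
      by (auto simp: span_Un)
    have "a - x \<in> span (insert a A)"
      using xy(2) span_mono[of A "insert a A"] by (intro span_diff) (auto intro: span_base)
    then have "a - x = 0"
      using insert.prems(3)[of "a - x"] xy by simp
    then show False
      using a xy by simp
  qed
  then show ?case
    using IH by (simp add: independent_insertI)
qed simp

context vector_space_pair
begin

text \<open>
  A linear map that stays injective modulo \<open>W\<close> on the span of \<open>X\<close> can be undone by a linear map
  that factors through the quotient by \<open>W\<close>.
\<close>
lemma exists_left_inverse_vanishing_on:
  assumes f: "Vector_Spaces.linear s1 s2 f" and W: "vs2.subspace W"
    and X: "finite X" "vs1.independent X"
    and inj: "\<And>x. x \<in> vs1.span X \<Longrightarrow> f x \<in> W \<Longrightarrow> x = 0"
  obtains G where "Vector_Spaces.linear s2 s1 G" "\<And>x. x \<in> vs1.span X \<Longrightarrow> G (f x) = x" "\<And>w. w \<in> W \<Longrightarrow> G w = 0"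
proof -
  interpret f: Vector_Spaces.linear s1 s2 f by (rule f)
  interpret rev: vector_space_pair s2 s1 by unfold_locales
  obtain C where C: "C \<subseteq> W" "vs2.independent C" "W \<subseteq> vs2.span C"
    using vs2.maximal_independent_subset[of W] by blast
  have spanC: "vs2.span C = W"
    using C W by (metis subset_antisym vs2.span_minimal)
  have injf: "inj_on f (vs1.span X)"
    using inj vs2.subspace_0[OF W] by (subst f.inj_on_iff_eq_0) (auto simp: vs1.subspace_span)
  have "vs2.independent (f ` X \<union> C)"
  proof (rule vs2.independent_Un)
    show "vs2.independent (f ` X)"
      using f.independent_injective_image[OF X(2) injf] .
    show "x = 0" if "x \<in> vs2.span (f ` X)" "x \<in> vs2.span C" for x
      using that inj f.zero unfolding f.span_image spanC by (metis imageE)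
  qed (use X C in auto)
  then obtain G where G: "Vector_Spaces.linear s2 s1 G"
      "\<forall>b\<in>f ` X \<union> C. G b = (if b \<in> f ` X then the_inv_into X f b else 0)"
    using rev.linear_independent_extend
      [of "f ` X \<union> C" "\<lambda>b. if b \<in> f ` X then the_inv_into X f b else 0"] by blast
  interpret G: Vector_Spaces.linear s2 s1 G by (rule G(1))
  have "x \<notin> C" if "x \<in> f ` X" for x
  proof
    assume "x \<in> C"
    with that C(1) obtain y where "y \<in> X" "f y \<in> W" by auto
    then have "0 \<in> X"
      using inj[of y] by (auto intro: vs1.span_base)
    with X(2) show False
      using vs1.dependent_zero by blast
  qed
  then have GC: "G c = 0" if "c \<in> C" for c
    using G(2) that by auto
  have GX: "(G \<circ> f) x = id x" if "x \<in> X" for x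
    using G(2) that inj_on_subset[OF injf vs1.span_superset] by (simp add: the_inv_into_f_f)
  show thesis
  proof
    show "Vector_Spaces.linear s2 s1 G" by (rule G(1))
    show "G w = 0" if "w \<in> W" for w
      using G.eq_0_on_span[of C w] GC that spanC by blast
    show "G (f x) = x" if "x \<in> vs1.span X" for x
    proof -
      interpret p: vector_space_pair s1 s1 by unfold_locales
      have GF: "Vector_Spaces.linear s1 s1 (G \<circ> f)"
        by (rule Vector_Spaces.linear_compose[OF f G(1)])
      have "(G \<circ> f) x = id x"
        by (rule p.linear_eq_on[OF GF vs1.linear_id that GX])
      then show ?thesis by simp
    qed
  qed
qed

text \<open>
  The rank of \<open>f + \<mu> g\<close> modulo \<open>W\<close> can drop below that of \<open>f\<close> for few \<open>\<mu>\<close> only. With \<open>G\<close> a left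
  inverse of \<open>f\<close> that vanishes on \<open>W\<close>, a vector \<open>x\<close> with \<open>f x + \<mu> g x \<in> W\<close> satisfies
  \<open>x + \<mu> G (g x) = 0\<close>, so it is an eigenvector of \<open>G \<circ> g\<close> for the eigenvalue \<open>-1/\<mu>\<close>. Eigenvectors
  for distinct eigenvalues are independent, and all of them lie in the span of \<open>X\<close>. This replaces
  the usual argument that a minor is a polynomial in \<open>\<mu>\<close> of degree at most \<open>card X\<close>.
\<close>
lemma pencil_degenerate_scalars:
  assumes f: "Vector_Spaces.linear s1 s2 f" and g: "Vector_Spaces.linear s1 s2 g" and W: "vs2.subspace W"
    and X: "finite X" "vs1.independent X"
    and inj: "\<And>x. x \<in> vs1.span X \<Longrightarrow> f x \<in> W \<Longrightarrow> x = 0"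
  defines "S \<equiv> {\<mu>. \<exists>x\<in>vs1.span X. x \<noteq> 0 \<and> f x + s2 \<mu> (g x) \<in> W}"
  shows "finite S \<and> card S \<le> card X"
proof (rule finite_if_finite_subsets_card_bdd)
  fix T assume T: "T \<subseteq> S" "finite T"
  obtain G where G: "Vector_Spaces.linear s2 s1 G" "\<And>x. x \<in> vs1.span X \<Longrightarrow> G (f x) = x"
      "\<And>w. w \<in> W \<Longrightarrow> G w = 0"
    using exists_left_inverse_vanishing_on[OF f W X inj] by blast
  interpret g: Vector_Spaces.linear s1 s2 g by (rule g)
  interpret G: Vector_Spaces.linear s2 s1 G by (rule G(1))
  have "\<forall>\<mu>\<in>S. \<exists>x. x \<in> vs1.span X \<and> x \<noteq> 0 \<and> f x + s2 \<mu> (g x) \<in> W"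
    by (auto simp: S_def)
  then obtain y where "\<forall>\<mu>\<in>S. y \<mu> \<in> vs1.span X \<and> y \<mu> \<noteq> 0 \<and> f (y \<mu>) + s2 \<mu> (g (y \<mu>)) \<in> W"
    by (rule bchoice[THEN exE])
  then have y: "y \<mu> \<in> vs1.span X \<and> y \<mu> \<noteq> 0 \<and> f (y \<mu>) + s2 \<mu> (g (y \<mu>)) \<in> W"
    if "\<mu> \<in> S" for \<mu>
    using that by blast
  define N where "N = G \<circ> g"
  have N: "Vector_Spaces.linear s1 s1 N"
    unfolding N_def by (rule Vector_Spaces.linear_compose[OF g G(1)])
  interpret N: Vector_Spaces.linear s1 s1 N by (rule N)
  have eig: "y \<mu> + s1 \<mu> (N (y \<mu>)) = 0" if "\<mu> \<in> S" for \<mu>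
    using y[OF that] G(2)[of "y \<mu>"] G(3)[of "f (y \<mu>) + s2 \<mu> (g (y \<mu>))"]
    by (simp add: G.add G.scale N_def)
  have nz: "\<mu> \<noteq> 0" if "\<mu> \<in> S" for \<mu>
    using eig[OF that] y[OF that] by auto
  have eig': "y \<mu> + s1 \<nu> (N (y \<mu>)) = s1 (1 - \<nu> / \<mu>) (y \<mu>)" if "\<mu> \<in> S" for \<mu> \<nu>
  proof -
    have "s1 \<nu> (N (y \<mu>)) = s1 (\<nu> / \<mu>) (s1 \<mu> (N (y \<mu>)))"
      using nz[OF that] by simp
    also have "s1 \<mu> (N (y \<mu>)) = - y \<mu>"
      using eig[OF that] by (simp add: eq_neg_iff_add_eq_0 add.commute)
    finally show ?thesis
      by (simp add: vs1.scale_left_diff_distrib)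
  qed
  have "inj_on y T \<and> vs1.independent (y ` T)"
    using T(2,1)
  proof (induction T)
    case (insert \<nu> T)
    have IH: "inj_on y T" "vs1.independent (y ` T)" and TS: "T \<subseteq> S" "\<nu> \<in> S"
      using insert by auto
    have "y \<nu> \<notin> vs1.span (y ` T)"
    proof
      assume "y \<nu> \<in> vs1.span (y ` T)"
      then obtain c where c: "y \<nu> = (\<Sum>v\<in>y ` T. s1 (c v) v)"
        using insert.hyps(1) by (auto simp: vs1.span_finite)
      \<comment> \<open>this map kills \<open>y \<nu>\<close> and rescales every other eigenvector by a nonzero factor\<close>
      define h where "h v = v + s1 \<nu> (N v)" for v
      have h_sum: "h (\<Sum>v\<in>B. s1 (c v) v) = (\<Sum>v\<in>B. s1 (c v) (h v))" for B
        unfolding h_def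
        by (simp add: N.sum N.scale vs1.scale_sum_right sum.distrib vs1.scale_right_distrib
            mult.commute)
      define k where "k = the_inv_into T y"
      have k: "k v \<in> T" "y (k v) = v" if "v \<in> y ` T" for v
        using that IH(1) unfolding k_def
        by (auto simp: the_inv_into_f_f)
      have "0 = h (y \<nu>)"
        using eig[OF TS(2)] by (simp add: h_def)
      also have "\<dots> = (\<Sum>v\<in>y ` T. s1 (c v) (h v))"
        by (subst c) (rule h_sum)
      also have "\<dots> = (\<Sum>v\<in>y ` T. s1 (c v * (1 - \<nu> / k v)) v)"
      proof (rule sum.cong)
        fix v assume "v \<in> y ` T"
        then show "s1 (c v) (h v) = s1 (c v * (1 - \<nu> / k v)) v"
          using eig'[of "k v" \<nu>] k[of v] TS(1) by (auto simp: h_def)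
      qed simp
      finally have z: "(\<Sum>v\<in>y ` T. s1 (c v * (1 - \<nu> / k v)) v) = 0" by simp
      have c0: "c v = 0" if v: "v \<in> y ` T" for v
      proof -
        have "c v * (1 - \<nu> / k v) = 0"
          by (rule vs1.independentD[OF IH(2) _ subset_refl z v]) (use insert.hyps in auto)
        moreover have "k v \<noteq> \<nu>" "k v \<noteq> 0"
          using k[OF v] insert.hyps nz TS by auto
        ultimately show ?thesis by (auto simp: field_simps)
      qed
      then have "y \<nu> = 0" using c by simp
      then show False using y TS by auto
    qed
    moreover from this have "y \<nu> \<notin> y ` T"
      using vs1.span_base by blast
    ultimately show ?case
      using IH insert.hyps(2) vs1.independent_insertI[of "y \<nu>" "y ` T"] by simp
  qed (simp add: vs1.independent_empty)
  then have "card T = card (y ` T)" "vs1.independent (y ` T)"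
    by (auto simp: card_image)
  moreover have "y ` T \<subseteq> vs1.span X"
    using y T by auto
  ultimately show "card T \<le> card X"
    using vs1.independent_span_bound[OF X(1)] by metis
qed

end

section \<open>Generic vectors of a subspace over a smaller field\<close>

lemma field_embeddingD:
  assumes "field_embedding h"
  shows "h 0 = 0" "h 1 = 1" "h (a + b) = h a + h b" "h (a * b) = h a * h b"
    "h (- a) = - h a" "h (a - b) = h a - h b" "h (sum f I) = (\<Sum>i\<in>I. h (f i))"
    "h a = 0 \<longleftrightarrow> a = 0" "h (a / b) = h a / h b" "h (a ^ k) = h a ^ k" "inj h"
proof -
  have h1: "h 1 = 1" and add: "\<And>a b. h (a + b) = h a + h b" and mult: "\<And>a b. h (a * b) = h a * h b"
    using assms by (auto simp: field_embedding_def)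
  show h0: "h 0 = 0"
    using add[of 0 0] by (metis add_0 add_cancel_right_right)
  show neg: "h (- a) = - h a" for a
    using add[of a "- a"] h0 by (simp add: eq_neg_iff_add_eq_0 add.commute)
  show diff: "h (a - b) = h a - h b" for a b
    using add[of a "- b"] neg by simp
  show "h (sum f I) = (\<Sum>i\<in>I. h (f i))"
    by (induction I rule: infinite_finite_induct) (auto simp: h0 add)
  show zero_iff: "h a = 0 \<longleftrightarrow> a = 0" for a
    using mult[of a "inverse a"] h0 h1 by (cases "a = 0") auto
  show "h (a / b) = h a / h b"
  proof (cases "b = 0")
    case False
    then show ?thesis
      using mult[of "a / b" b] zero_iff[of b] by (simp add: field_simps)
  qed (simp add: h0)
  show "h (a ^ k) = h a ^ k"
    by (induction k) (auto simp: h1 mult)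
  show "inj h"
    using diff zero_iff by (metis injI right_minus_eq)
qed (use assms in \<open>auto simp: field_embedding_def\<close>)

text \<open>
  A space over the large field \<open>'l\<close> is also seen as a space over the small field \<open>'e\<close>, and so is
  \<open>'l\<close> itself. The names \<open>E\<close> and \<open>L\<close> prefix linear algebra over \<open>'e\<close> in the space and in \<open>'l\<close>.
\<close>
locale scalar_extension = vector_space s
  for s :: "'l::field \<Rightarrow> 'y::ab_group_add \<Rightarrow> 'y" +
  fixes j :: "'e::field \<Rightarrow> 'l"
  assumes embedding: "field_embedding j"
begin

abbreviation sE :: "'e \<Rightarrow> 'y \<Rightarrow> 'y" where "sE \<equiv> restrict_scalars j s"
abbreviation mE :: "'e \<Rightarrow> 'l \<Rightarrow> 'l" where "mE \<equiv> restrict_scalars j (*)"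

sublocale E: vector_space sE
  using vector_space_restrict_scalars[OF vector_space_axioms embedding] .

sublocale L: vector_space mE
  by (rule vector_space_restrict_scalars[OF _ embedding]) (unfold_locales, auto simp: algebra_simps)

sublocale LE: vector_space_pair mE sE ..

lemmas j_simps = field_embeddingD[OF embedding]

lemma sE_commute: "s x (sE c v) = sE c (s x v)"
  by (simp add: restrict_scalars_def mult.commute)

lemma s_mE: "s (mE c x) v = sE c (s x v)"
  by (simp add: restrict_scalars_def)

lemma linear_orbit: "Vector_Spaces.linear mE sE (\<lambda>x. s x v)"
  by (auto simp: Vector_Spaces.linear_iff L.vector_space_axioms E.vector_space_axioms
      scale_left_distrib s_mE)

text \<open>
  The set \<open>X\<close> witnesses that \<open>x \<mapsto> x v\<close>, as an \<open>'e\<close>-linear map to the quotient by \<open>W\<close>, has rank at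
  least \<open>card X\<close>. When \<open>'l\<close> has degree \<open>n\<close>, the weight of \<open>v\<close> with respect to \<open>W\<close> is \<open>n\<close> minus the
  largest such cardinality, so weights are compared without speaking of dimensions.
\<close>
definition free_at :: "'l set \<Rightarrow> 'y \<Rightarrow> 'y set \<Rightarrow> bool" where
  "free_at X v W \<longleftrightarrow> finite X \<and> L.independent X \<and> (\<forall>x\<in>L.span X. s x v \<in> W \<longrightarrow> x = 0)"

lemma free_at_subset: "free_at X v W \<Longrightarrow> Y \<subseteq> X \<Longrightarrow> free_at Y v W"
  using L.span_mono[of Y X] L.independent_mono[of X Y] finite_subset[of Y X]
  by (auto simp: free_at_def)

lemma free_at_scale:
  assumes "free_at X v W" "E.subspace W" "c \<noteq> 0"
  shows "free_at X (sE c v) W"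
  unfolding free_at_def
proof (intro conjI ballI impI)
  fix x assume x: "x \<in> L.span X" "s x (sE c v) \<in> W"
  then have "sE (inverse c) (s x (sE c v)) \<in> W"
    using assms(2) E.subspace_scale by blast
  also have "sE (inverse c) (s x (sE c v)) = s x v"
    using assms(3) by (simp add: sE_commute)
  finally show "x = 0"
    using assms(1) x(1) by (simp add: free_at_def)
qed (use assms(1) in \<open>auto simp: free_at_def\<close>)

lemma free_at_insert:
  assumes X: "free_at X v W" and W: "E.subspace W"
    and a: "\<And>x. x \<in> L.span X \<Longrightarrow> s (a - x) v \<notin> W"
  shows "free_at (insert a X) v W"
  unfolding free_at_def
proof (intro conjI ballI impI)
  have "a \<notin> L.span X"
    using a[of a] E.subspace_0[OF W] by auto
  then show "L.independent (insert a X)"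
    using X by (simp add: free_at_def L.independent_insertI)
  fix y assume y: "y \<in> L.span (insert a X)" "s y v \<in> W"
  then obtain c where c: "y - mE c a \<in> L.span X"
    by (auto simp: L.span_breakdown_eq)
  show "y = 0"
  proof (cases "c = 0")
    case True
    then show ?thesis
      using c y(2) X by (simp add: free_at_def)
  next
    case False
    define x where "x = mE (- inverse c) (y - mE c a)"
    have "x \<in> L.span X"
      unfolding x_def using c by (rule L.span_scale)
    moreover have "a - x = mE (inverse c) y"
      using False by (simp add: x_def L.scale_right_diff_distrib)
    moreover have "s (mE (inverse c) y) v \<in> W"
      unfolding s_mE using y(2) W by (simp add: E.subspace_scale)
    ultimately show ?thesis
      using a[of x] by simp
  qed
qed (use X in \<open>simp add: free_at_def\<close>)

lemma free_at_perturb: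
  assumes X: "free_at X v W" and W: "E.subspace W"
  shows "finite {\<mu>. \<not> free_at X (v + sE \<mu> v') W}"
    and "card {\<mu>. \<not> free_at X (v + sE \<mu> v') W} \<le> card X"
proof -
  have "{\<mu>. \<not> free_at X (v + sE \<mu> v') W} =
      {\<mu>. \<exists>x\<in>L.span X. x \<noteq> 0 \<and> s x v + sE \<mu> (s x v') \<in> W}"
    using X by (auto simp: free_at_def scale_right_distrib sE_commute)
  then show "finite {\<mu>. \<not> free_at X (v + sE \<mu> v') W}"
    and "card {\<mu>. \<not> free_at X (v + sE \<mu> v') W} \<le> card X"
    using LE.pencil_degenerate_scalars[OF linear_orbit[of v] linear_orbit[of v'] W, of X] X
    by (auto simp: free_at_def)
qed

text \<open>
  Coefficients can be moved into a prescribed set \<open>A\<close> one at a time: each move has more than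
  \<open>card X\<close> targets, and at most \<open>card X\<close> of them destroy freeness.
\<close>
lemma free_at_specialise:
  assumes W: "E.subspace W" and "finite S" and A: "card X < card A"
    and "free_at X (v + (\<Sum>b\<in>S. sE (d b) b)) W"
  shows "\<exists>c. range c \<subseteq> A \<and> free_at X (v + (\<Sum>b\<in>S. sE (c b) b)) W"
  using assms(2,4)
proof (induction S arbitrary: v)
  case empty
  obtain a where "a \<in> A" using A by fastforce
  with empty show ?case by (intro exI[of _ "\<lambda>_. a"]) auto
next
  case (insert b S)
  let ?v = "v + (\<Sum>b\<in>insert b S. sE (d b) b)"
  let ?bad = "{\<mu>. \<not> free_at X (?v + sE \<mu> b) W}"
  have "card ((\<lambda>a. a - d b) ` A) = card A"
    by (intro card_image) (auto simp: inj_on_def)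
  then have "\<not> (\<lambda>a. a - d b) ` A \<subseteq> ?bad"
    using card_mono[OF free_at_perturb(1)[OF insert.prems W, of b], of "(\<lambda>a. a - d b) ` A"]
      free_at_perturb(2)[OF insert.prems W, of b] A by linarith
  then obtain a where a: "a \<in> A" "free_at X (?v + sE (a - d b) b) W"
    by auto
  have eq: "?v + sE (a - d b) b = (v + sE a b) + (\<Sum>b\<in>S. sE (d b) b)"
    using insert.hyps by (simp add: E.scale_left_diff_distrib)
  then obtain c where c: "range c \<subseteq> A" "free_at X ((v + sE a b) + (\<Sum>b\<in>S. sE (c b) b)) W"
    using insert.IH[of "v + sE a b"] a(2) unfolding eq by blast
  have eq': "(v + sE a b) + (\<Sum>b\<in>S. sE (c b) b) = v + (\<Sum>x\<in>insert b S. sE ((c(b := a)) x) x)"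
    using insert.hyps by (auto simp: add.assoc intro!: sum.cong arg_cong2[where f = "(+)"])
  have "range (c(b := a)) \<subseteq> A"
    using c(1) a(1) by auto
  then show ?case
    using c(2) unfolding eq' by blast
qed

text \<open>
  Largest free sets mean least weight, so these are the vectors of \<open>U\<close> of least weight with respect
  to \<open>W\<close>.
\<close>
definition generic :: "'y set \<Rightarrow> 'y set \<Rightarrow> 'y \<Rightarrow> bool" where
  "generic U W u \<longleftrightarrow> u \<in> U \<and>
     (\<exists>X. free_at X u W \<and> (\<forall>v\<in>U. \<forall>Y. free_at Y v W \<longrightarrow> card Y \<le> card X))"

text \<open>
  On the line through a vector generic for some of the subspaces and a vector generic for another
  one, only finitely many points fail to be generic for all of them.
\<close>
lemma exists_simultaneously_generic:
  assumes inf: "infinite (UNIV :: 'e set)" and bound: "\<And>X. finite X \<Longrightarrow> L.independent X \<Longrightarrow> card X \<le> n"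
    and U: "E.subspace U" and fin: "finite Ws" and Ws: "\<And>W. W \<in> Ws \<Longrightarrow> E.subspace W"
  shows "\<exists>u\<in>U. \<forall>W\<in>Ws. generic U W u"
  using fin Ws
proof (induction Ws)
  case empty
  show ?case using E.subspace_0[OF U] by blast
next
  case (insert W Ws)
  obtain u where u: "u \<in> U" "\<forall>W\<in>Ws. generic U W u"
    using insert.IH insert.prems by auto
  let ?P = "\<lambda>k. \<exists>v\<in>U. \<exists>X. free_at X v W \<and> card X = k"
  have "\<exists>k. ?P k \<and> (\<forall>l. ?P l \<longrightarrow> l \<le> k)"
  proof (rule Nat.ex_has_greatest_nat[of ?P 0 n])
    show "?P 0"
      using u(1) by (intro bexI[of _ u] exI[of _ "{}"]) (auto simp: free_at_def L.dependent_explicit)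
    show "\<forall>l. ?P l \<longrightarrow> l \<le> n"
      using bound by (auto simp: free_at_def)
  qed
  then obtain v X where v: "v \<in> U" "free_at X v W"
      and max: "\<And>v' Y. v' \<in> U \<Longrightarrow> free_at Y v' W \<Longrightarrow> card Y \<le> card X"
    by blast
  have "\<forall>W\<in>Ws. \<exists>X. free_at X u W \<and> (\<forall>v\<in>U. \<forall>Y. free_at Y v W \<longrightarrow> card Y \<le> card X)"
    using u(2) by (auto simp: generic_def)
  then obtain Z where Z: "\<forall>W\<in>Ws. free_at (Z W) u W \<and> (\<forall>v\<in>U. \<forall>Y. free_at Y v W \<longrightarrow> card Y \<le> card (Z W))"
    by (rule bchoice[THEN exE])
  let ?bad = "{0} \<union> inverse ` {\<mu>. \<not> free_at X (v + sE \<mu> u) W} \<union>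
      (\<Union>W\<in>Ws. {\<mu>. \<not> free_at (Z W) (u + sE \<mu> v) W})"
  have "finite ?bad"
    using free_at_perturb(1) v(2) Z insert.prems insert.hyps by auto
  then obtain \<mu> where "\<mu> \<notin> ?bad"
    by (rule exE[OF ex_new_if_finite[OF inf]])
  then have \<mu>: "\<mu> \<noteq> 0" "\<And>W. W \<in> Ws \<Longrightarrow> free_at (Z W) (u + sE \<mu> v) W"
    and "free_at X (v + sE (inverse \<mu>) u) W"
    by (auto simp: image_iff)
  then have "free_at X (sE \<mu> (v + sE (inverse \<mu>) u)) W"
    using free_at_scale insert.prems by blast
  then have "free_at X (u + sE \<mu> v) W"
    using \<mu>(1) by (simp add: E.scale_right_distrib add.commute)
  moreover have "u + sE \<mu> v \<in> U"
    using U u(1) v(1) by (simp add: E.subspace_add E.subspace_scale)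
  ultimately have "\<forall>W'\<in>insert W Ws. generic U W' (u + sE \<mu> v)"
    using max Z \<mu>(2) unfolding generic_def by blast
  then show ?case
    using \<open>u + sE \<mu> v \<in> U\<close> by blast
qed

text \<open>
  At a generic vector the rank of \<open>x \<mapsto> x u\<close> modulo \<open>W\<close> is maximal, hence constant nearby. If
  \<open>\<alpha>\<close> is in the kernel, then along \<open>u + \<mu> v\<close> it deforms to a kernel vector \<open>\<alpha> + \<mu> \<alpha>' + \<dots>\<close>, and
  the coefficient of \<open>\<mu>\<close> says that \<open>\<alpha> v + \<alpha>' u \<in> W\<close>. The proof avoids power series: if \<open>\<alpha> v\<close> were outside \<open>W + 'l u\<close>, then \<open>\<alpha>\<close>
  could be added to a largest free set of \<open>u\<close>, giving a larger free set at some \<open>u + \<mu> v\<close>.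
\<close>
lemma tangent_at_generic:
  assumes inf: "infinite (UNIV :: 'e set)" and U: "E.subspace U" and W: "E.subspace W"
    and u: "generic U W u" and \<alpha>: "s \<alpha> u \<in> W" and v: "v \<in> U"
  shows "\<exists>w\<in>W. \<exists>\<beta>. s \<alpha> v = w + s \<beta> u"
proof (rule ccontr)
  assume no: "\<not> (\<exists>w\<in>W. \<exists>\<beta>. s \<alpha> v = w + s \<beta> u)"
  obtain X where X: "free_at X u W" and max: "\<And>v Y. v \<in> U \<Longrightarrow> free_at Y v W \<Longrightarrow> card Y \<le> card X"
    using u by (auto simp: generic_def)
  have "\<alpha> \<noteq> 0"
    using no E.subspace_0[OF W] by (metis add.right_neutral scale_zero_left)
  then have \<alpha>X: "\<alpha> \<notin> L.span X"
    using X \<alpha> by (auto simp: free_at_def)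
  then have ind: "L.independent (insert \<alpha> X)" and fin: "finite (insert \<alpha> X)"
    using X by (auto simp: free_at_def L.independent_insertI)
  have \<alpha>X': "\<alpha> \<notin> X"
    using \<alpha>X L.span_base by blast
  \<comment> \<open>for \<open>\<mu> \<noteq> 0\<close> the image of \<open>\<alpha>\<close> at \<open>u + \<mu> v\<close> is \<open>\<mu> (\<alpha> v)\<close> modulo \<open>W\<close>; after division by \<open>\<mu>\<close>
    it is constant in \<open>\<mu>\<close>, which is why \<open>g\<close> vanishes at \<open>\<alpha>\<close>\<close>
  obtain f where f: "Vector_Spaces.linear mE sE f"
      "\<forall>x\<in>insert \<alpha> X. f x = (if x = \<alpha> then s \<alpha> v else s x u)"
    using LE.linear_independent_extend[OF ind, of "\<lambda>x. if x = \<alpha> then s \<alpha> v else s x u"] by blast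
  obtain g where g: "Vector_Spaces.linear mE sE g"
      "\<forall>x\<in>insert \<alpha> X. g x = (if x = \<alpha> then 0 else s x v)"
    using LE.linear_independent_extend[OF ind, of "\<lambda>x. if x = \<alpha> then 0 else s x v"] by blast
  interpret f: Vector_Spaces.linear mE sE f by (rule f(1))
  interpret g: Vector_Spaces.linear mE sE g by (rule g(1))
  have fX: "f x = s x u" if "x \<in> L.span X" for x
    by (rule LE.linear_eq_on[OF f(1) linear_orbit that]) (use f(2) \<alpha>X' in auto)
  have gX: "g x = s x v" if "x \<in> L.span X" for x
    by (rule LE.linear_eq_on[OF g(1) linear_orbit that]) (use g(2) \<alpha>X' in auto)
  have f\<alpha>: "f \<alpha> = s \<alpha> v" and g\<alpha>: "g \<alpha> = 0"
    using f(2) g(2) by auto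
  have inj: "x = 0" if x: "x \<in> L.span (insert \<alpha> X)" "f x \<in> W" for x
  proof -
    obtain c where c: "x - mE c \<alpha> \<in> L.span X"
      using x(1) by (auto simp: L.span_breakdown_eq)
    define y where "y = x - mE c \<alpha>"
    have y: "y \<in> L.span X" "x = y + mE c \<alpha>" using c by (auto simp: y_def)
    have fx: "f x = s y u + sE c (s \<alpha> v)"
      using y fX f\<alpha> by (simp add: f.add f.scale)
    have "c = 0"
    proof (rule ccontr)
      assume c0: "c \<noteq> 0"
      have "sE (inverse c) (f x) \<in> W"
        using x(2) W E.subspace_scale by blast
      moreover have "s \<alpha> v = sE (inverse c) (f x) + s (mE (- inverse c) y) u"
        using c0 unfolding fx s_mE by (simp add: E.scale_right_distrib)
      ultimately show False using no by blast
    qed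
    then show ?thesis
      using y x(2) fx X by (auto simp: free_at_def)
  qed
  have "finite {\<mu>. \<exists>x\<in>L.span (insert \<alpha> X). x \<noteq> 0 \<and> f x + sE \<mu> (g x) \<in> W}"
    using LE.pencil_degenerate_scalars[OF f(1) g(1) W fin ind inj] by blast
  then obtain \<mu> where "\<mu> \<notin> insert 0 {\<mu>. \<exists>x\<in>L.span (insert \<alpha> X). x \<noteq> 0 \<and> f x + sE \<mu> (g x) \<in> W}"
    using inf ex_new_if_finite by (metis (no_types, lifting) finite_insert)
  then have \<mu>: "\<mu> \<noteq> 0" and good: "\<And>x. x \<in> L.span (insert \<alpha> X) \<Longrightarrow> f x + sE \<mu> (g x) \<in> W \<Longrightarrow> x = 0"
    by auto
  have "free_at (insert \<alpha> X) (u + sE \<mu> v) W"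
    unfolding free_at_def
  proof (intro conjI ballI impI fin ind)
    fix x assume x: "x \<in> L.span (insert \<alpha> X)" "s x (u + sE \<mu> v) \<in> W"
    obtain c where c: "x - mE c \<alpha> \<in> L.span X"
      using x(1) by (auto simp: L.span_breakdown_eq)
    define y where "y = x - mE c \<alpha>"
    have y: "y \<in> L.span X" "x = y + mE c \<alpha>" using c by (auto simp: y_def)
    \<comment> \<open>as \<open>\<alpha> u \<in> W\<close>, modulo \<open>W\<close> the factor \<open>\<mu>\<close> can be moved from \<open>v\<close> to \<open>\<alpha>\<close>\<close>
    define z where "z = y + mE (\<mu> * c) \<alpha>"
    have z: "z \<in> L.span (insert \<alpha> X)"
      unfolding z_def using y(1) L.span_mono[of X "insert \<alpha> X"]
      by (intro L.span_add L.span_scale) (auto intro: L.span_base)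
    have "f z + sE \<mu> (g z) = s x (u + sE \<mu> v) - sE c (s \<alpha> u)"
      unfolding z_def y(2) f.add f.scale g.add g.scale fX[OF y(1)] gX[OF y(1)] f\<alpha> g\<alpha>
      by (simp add: scale_left_distrib scale_right_distrib sE_commute s_mE
          E.scale_right_distrib mult.commute)
    also have "\<dots> \<in> W"
      using x(2) \<alpha> W by (intro E.subspace_diff E.subspace_scale) auto
    finally have "z = 0" using good z by blast
    then have "mE (\<mu> * c) \<alpha> = - y"
      by (simp add: z_def eq_neg_iff_add_eq_0 add.commute)
    then have "mE (\<mu> * c) \<alpha> \<in> L.span X"
      using y(1) L.span_neg by auto
    then have "mE (inverse (\<mu> * c)) (mE (\<mu> * c) \<alpha>) \<in> L.span X"
      by (rule L.span_scale)
    then have "\<mu> * c = 0"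
      using \<alpha>X unfolding L.scale_scale by (metis L.scale_one left_inverse)
    then show "x = 0"
      using \<open>z = 0\<close> \<mu> y(2) by (auto simp: z_def)
  qed
  moreover have "u + sE \<mu> v \<in> U"
    using u v U by (simp add: generic_def E.subspace_add E.subspace_scale)
  ultimately have "card (insert \<alpha> X) \<le> card X"
    using max by blast
  then show False
    using \<alpha>X' fin by simp
qed

text \<open>
  Modulo the line of \<open>u\<close>, this is the image of the differential at \<open>u\<close> of the map that sends a vector
  of \<open>U\<close> to the projective point it spans.
\<close>

definition orbit_sum :: "'y set \<Rightarrow> 'y \<Rightarrow> 'y set" where
  "orbit_sum U u = {x + s \<beta> u | x \<beta>. x \<in> U}"

definition stabiliser :: "'y set \<Rightarrow> 'l set" where
  "stabiliser M = {\<beta>. \<forall>x\<in>M. s \<beta> x \<in> M}"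

lemma subset_orbit_sum: "U \<subseteq> orbit_sum U u"
proof
  fix x assume "x \<in> U"
  moreover have "x = x + s 0 u" by simp
  ultimately show "x \<in> orbit_sum U u" unfolding orbit_sum_def by blast
qed

lemma multiple_in_orbit_sum: "E.subspace U \<Longrightarrow> s \<beta> u \<in> orbit_sum U u"
  unfolding orbit_sum_def using E.subspace_0 by (metis (mono_tags, lifting) add_0 mem_Collect_eq)

lemma subspace_orbit_sum:
  assumes U: "E.subspace U"
  shows "E.subspace (orbit_sum U u)"
proof (rule E.subspaceI)
  show "0 \<in> orbit_sum U u"
    using subset_orbit_sum E.subspace_0[OF U] by blast
  show "x + y \<in> orbit_sum U u" if xy: "x \<in> orbit_sum U u" "y \<in> orbit_sum U u" for x y
  proof -
    obtain x' y' \<beta> \<gamma> where "x = x' + s \<beta> u" "y = y' + s \<gamma> u" "x' \<in> U" "y' \<in> U"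
      using xy unfolding orbit_sum_def by blast
    then have "x + y = (x' + y') + s (\<beta> + \<gamma>) u" "x' + y' \<in> U"
      using E.subspace_add[OF U] by (simp_all add: scale_left_distrib add_ac)
    then show ?thesis unfolding orbit_sum_def by blast
  qed
  show "sE e x \<in> orbit_sum U u" if x: "x \<in> orbit_sum U u" for e x
  proof -
    obtain x' \<beta> where "x = x' + s \<beta> u" "x' \<in> U"
      using x unfolding orbit_sum_def by blast
    then have "sE e x = sE e x' + s (j e * \<beta>) u" "sE e x' \<in> U"
      using E.subspace_scale[OF U] by (simp_all add: scale_right_distrib restrict_scalars_def)
    then show ?thesis unfolding orbit_sum_def by blast
  qed
qed

lemma stabiliser_ring:
  assumes M: "E.subspace M"
  shows "range j \<subseteq> stabiliser M"
    and "\<And>a b. a \<in> stabiliser M \<Longrightarrow> b \<in> stabiliser M \<Longrightarrow> a + b \<in> stabiliser M"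
    and "\<And>a b. a \<in> stabiliser M \<Longrightarrow> b \<in> stabiliser M \<Longrightarrow> a * b \<in> stabiliser M"
proof -
  show "range j \<subseteq> stabiliser M"
    using E.subspace_scale[OF M] by (auto simp: stabiliser_def restrict_scalars_def)
  show "a + b \<in> stabiliser M" if "a \<in> stabiliser M" "b \<in> stabiliser M" for a b
    using that E.subspace_add[OF M] by (auto simp: stabiliser_def scale_left_distrib)
  show "a * b \<in> stabiliser M" if "a \<in> stabiliser M" "b \<in> stabiliser M" for a b
    using that by (auto simp: stabiliser_def simp flip: scale_scale)
qed

text \<open>
  Hence the scalars that keep a generic vector inside \<open>W\<close>, which a priori form only a subspace of
  \<open>'l\<close>, all lie in one intermediate ring. With \<open>W = U\<close> the dimension of that subspace is the least
  weight.
\<close>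

lemma multiplier_of_generic_in_stabiliser:
  assumes inf: "infinite (UNIV :: 'e set)" and U: "E.subspace U"
    and W: "E.subspace W" "W \<subseteq> orbit_sum U u" and u: "generic U W u" and \<alpha>: "s \<alpha> u \<in> W"
  shows "\<alpha> \<in> stabiliser (orbit_sum U u)"
proof -
  have "s \<alpha> x \<in> orbit_sum U u" if x: "x \<in> orbit_sum U u" for x
  proof -
    obtain y \<beta> where y: "x = y + s \<beta> u" "y \<in> U"
      using x unfolding orbit_sum_def by blast
    obtain z \<gamma> where z: "s \<alpha> y = z + s \<gamma> u" "z \<in> W"
      using tangent_at_generic[OF inf U W(1) u \<alpha> y(2)] by blast
    have "s \<alpha> x = z + (s \<gamma> u + s (\<alpha> * \<beta>) u)"
      using z(1) y(1) by (simp add: scale_right_distrib add.assoc)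
    also have "\<dots> \<in> orbit_sum U u"
      using z(2) W(2) by (intro E.subspace_add[OF subspace_orbit_sum[OF U]] multiple_in_orbit_sum[OF U]) auto
    finally show ?thesis .
  qed
  then show ?thesis by (simp add: stabiliser_def)
qed

end

section \<open>Subfields of finite fields\<close>

lemma card_frobenius_fixed_le:
  fixes Q :: nat
  assumes "Q \<ge> 2"
  shows "finite {x :: 'f::field. x ^ Q = x}" "card {x :: 'f. x ^ Q = x} \<le> Q"
proof -
  define p :: "'f poly" where "p = monom 1 Q - monom 1 1"
  have deg: "degree p = Q"
    unfolding p_def using assms
    by (subst diff_conv_add_uminus, subst degree_add_eq_left) (auto simp: degree_monom_eq)
  then have "p \<noteq> 0" using assms by auto
  have roots: "{x. x ^ Q = x} = {x. poly p x = 0}"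
    by (auto simp: p_def poly_monom)
  show "finite {x :: 'f. x ^ Q = x}"
    unfolding roots by (rule poly_roots_finite) fact
  show "card {x :: 'f. x ^ Q = x} \<le> Q"
    unfolding roots using card_poly_roots_bound[OF \<open>p \<noteq> 0\<close>] deg by simp
qed

lemma is_subfield_power_card:
  assumes "is_subfield (D :: 'f::field set)" "finite D" "x \<in> D"
  shows "x ^ card D = x"
proof (cases "x = 0")
  case False
  have D: "0 \<in> D" "\<And>y. y \<in> D \<Longrightarrow> x * y \<in> D" "\<And>y. y \<in> D \<Longrightarrow> y / x \<in> D"
    using assms False by (auto simp: is_subfield_def divide_inverse)
  have "(\<Prod>y\<in>D - {0}. x * y) = (\<Prod>y\<in>D - {0}. y)"
    by (rule prod.reindex_bij_witness[of _ "\<lambda>y. y / x" "\<lambda>y. x * y"]) (use False D in auto)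
  then have "x ^ card (D - {0}) * (\<Prod>y\<in>D - {0}. y) = 1 * (\<Prod>y\<in>D - {0}. y)"
    by (simp add: prod.distrib)
  moreover have "(\<Prod>y\<in>D - {0}. y) \<noteq> 0"
    using assms(2) by simp
  ultimately have "x ^ card (D - {0}) = 1"
    by (metis mult_cancel_right)
  then have "x ^ Suc (card (D - {0})) = x" by simp
  then show ?thesis
    using card_Suc_Diff1[OF assms(2) D(1)] by simp
qed (use assms in \<open>auto simp: card_gt_0_iff zero_power\<close>)


lemma is_subfield_UNIV: "is_subfield (UNIV :: 'f::field set)"
  by (simp add: is_subfield_def)

text \<open>
  With \<open>g = gcd d n\<close>, every element of \<open>D\<close> is fixed by the powers \<open>q ^ d\<close> and \<open>q ^ n\<close>, hence by
  \<open>q ^ g\<close>; so \<open>D\<close> has at most \<open>q ^ g\<close> elements and \<open>d = g\<close>.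
\<close>
lemma subfield_degree_dvd:
  fixes D :: "'k::{field,finite} set" and q :: nat
  assumes D: "is_subfield D" "card D = q ^ d" and K: "CARD('k) = q ^ n" and q: "q \<ge> 2"
  shows "d dvd n"
proof (cases "d = 0")
  case True
  have "card {0, 1 :: 'k} \<le> card D"
    using D(1) by (intro card_mono) (auto simp: is_subfield_def)
  then show ?thesis using True D(2) by simp
next
  case False
  define g where "g = gcd d n"
  obtain a b where ab: "d * a = n * b + g"
    using bezout_nat[OF False, of n] by (auto simp: g_def)
  have iter: "x ^ (q ^ (k * l)) = x" if "x ^ (q ^ k) = x" for x :: 'k and k l
    by (induction l) (simp_all add: that power_add power_mult)
  have "x ^ (q ^ g) = x" if "x \<in> D" for x
  proof -
    have "x ^ (q ^ d) = x" "x ^ (q ^ n) = x"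
      using is_subfield_power_card[OF D(1) _ that] is_subfield_power_card[OF is_subfield_UNIV, of x] D(2) K
      by auto
    then have "x = x ^ (q ^ (d * a))" "x ^ (q ^ (n * b)) = x"
      using iter by auto
    then show ?thesis
      unfolding ab by (simp add: power_add power_mult)
  qed
  then have sub: "D \<subseteq> {x. x ^ (q ^ g) = x}"
    by blast
  have qg: "q ^ g \<ge> 2"
    using False q by (intro order_trans[OF q]) (auto simp: g_def self_le_power)
  have "card D \<le> q ^ g"
    by (rule order_trans[OF card_mono[OF card_frobenius_fixed_le(1)[OF qg] sub]
        card_frobenius_fixed_le(2)[OF qg]])
  then have "d \<le> g"
    using D(2) q by (simp add: power_increasing_iff)
  then have "d = g"
    using False by (metis g_def gcd_le1_nat le_antisym)
  then show ?thesis by (metis g_def gcd_dvd2)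
qed

lemma CHAR_prime_power_card:
  assumes "primepow CARD('a::{field,finite})"
  shows "prime CHAR('a)" "\<exists>t. CARD('a) = CHAR('a) ^ t"
proof -
  have "(\<Sum>x\<in>UNIV. x + 1) = (\<Sum>x\<in>UNIV. x :: 'a)"
    by (rule sum.reindex_bij_witness[of _ "\<lambda>x. x - 1" "\<lambda>x. x + 1"]) auto
  then have "of_nat CARD('a) = (0 :: 'a)"
    by (simp add: sum.distrib)
  then have dvd: "CHAR('a) dvd CARD('a)"
    by (simp add: of_nat_eq_0_iff_char_dvd)
  have "CHAR('a) > 0"
    using finite_imp_CHAR_pos[where ?'a = 'a] by simp
  then show pr: "prime CHAR('a)"
    by (rule prime_CHAR_semidom)
  obtain p k where p: "prime p" "CARD('a) = p ^ k"
    using assms by (auto simp: primepow_def)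
  then have "CHAR('a) = p"
    using dvd pr prime_dvd_power primes_dvd_imp_eq by metis
  then show "\<exists>t. CARD('a) = CHAR('a) ^ t"
    using p by auto
qed

lemma field_embedding_CHAR:
  assumes "field_embedding (h :: 'a::field \<Rightarrow> 'b::field)"
  shows "CHAR('b) = CHAR('a)"
proof (rule CHAR_eqI)
  have h: "h (of_nat k) = of_nat k" for k
    using assms by (induction k) (auto simp: field_embeddingD[OF assms])
  show "of_nat CHAR('a) = (0 :: 'b)"
    using h[of "CHAR('a)"] field_embeddingD(1)[OF assms] by simp
  show "CHAR('a) dvd x" if "of_nat x = (0 :: 'b)" for x
  proof -
    have "of_nat x = (0 :: 'a)"
      using that h[of x] field_embeddingD(8)[OF assms] by metis
    then show ?thesis by (simp only: of_nat_eq_0_iff_char_dvd)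
  qed
qed


section \<open>Intermediate rings of constant field extensions\<close>

text \<open>
  The exponent \<open>Q\<close> is a power of the characteristic whose power map fixes the constants. So
  \<open>b \<mapsto> b ^ Q - b\<close> maps the ring \<open>B\<close> to itself and is linear over the constants \<open>range \<iota>\<close>. After
  dividing by \<open>j (f i)\<close> the term at \<open>i\<close> is constant and this map removes it. The remaining
  \<open>g x ^ Q - g x\<close>, with \<open>g x = f x / f i\<close>, are again independent because \<open>'e\<close> contains no further
  fixed points of the power map than \<open>range e0\<close>.
\<close>
lemma coefficients_in_intermediate_ring:
  fixes j :: "'e::field \<Rightarrow> 'l::field" and \<iota> :: "'k::field \<Rightarrow> 'l" and e0 :: "'a::field \<Rightarrow> 'e"
  assumes emb: "field_embedding j" "field_embedding \<iota>" "field_embedding e0"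
    and char: "prime CHAR('e)" "CHAR('l) = CHAR('e)" "Q = CHAR('e) ^ t"
    and frob: "\<And>x. \<iota> x ^ Q = \<iota> x" "\<And>a. e0 a ^ Q = e0 a" and fixE: "\<And>x. x ^ Q = x \<Longrightarrow> x \<in> range e0"
    and B: "range j \<subseteq> B" "\<And>x y. x \<in> B \<Longrightarrow> y \<in> B \<Longrightarrow> x + y \<in> B" "\<And>x y. x \<in> B \<Longrightarrow> y \<in> B \<Longrightarrow> x * y \<in> B"
  shows "\<lbrakk>finite I; \<And>c. (\<Sum>i\<in>I. e0 (c i) * f i) = 0 \<Longrightarrow> \<forall>i\<in>I. c i = 0;
      (\<Sum>i\<in>I. \<iota> (\<kappa> i) * j (f i)) \<in> B\<rbrakk> \<Longrightarrow> \<forall>i\<in>I. \<iota> (\<kappa> i) \<in> B"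
proof (induction I arbitrary: f rule: finite_induct)
  case (insert i I)
  note jD = field_embeddingD[OF emb(1)] and eD = field_embeddingD[OF emb(3)]
  have Bneg: "- x \<in> B" if "x \<in> B" for x
  proof -
    have "j (- 1) \<in> B" using B(1) by blast
    from B(3)[OF this that] show ?thesis by (simp add: jD)
  qed
  have Bdiff: "x - y \<in> B" if "x \<in> B" "y \<in> B" for x y
    using B(2)[of x "- y"] Bneg that by auto
  have Bpow: "x ^ Suc k \<in> B" if "x \<in> B" for x k
    by (induction k) (use that B(3) in auto)
  have Q: "Q > 0"
    using char prime_gt_0_nat by simp
  have fi: "f i \<noteq> 0"
  proof
    assume "f i = 0"
    then have "(\<Sum>x\<in>insert i I. e0 (if x = i then 1 else 0) * f x) = 0"
      by (intro sum.neutral) (auto simp: eD)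
    from insert.prems(1)[OF this] show False by auto
  qed
  define g where "g x = f x / f i" for x
  have gi: "g i = 1" using fi by (simp add: g_def)
  define b where "b = (\<Sum>x\<in>insert i I. \<iota> (\<kappa> x) * j (g x))"
  have "b = (\<Sum>x\<in>insert i I. \<iota> (\<kappa> x) * j (f x)) * j (inverse (f i))"
    unfolding b_def g_def sum_distrib_right
    by (intro sum.cong) (simp_all add: divide_inverse jD)
  moreover have "j (inverse (f i)) \<in> B" using B(1) by blast
  ultimately have b: "b \<in> B"
    using B(3)[OF insert.prems(2)] by simp
  have "b ^ Q = (\<Sum>x\<in>insert i I. (\<iota> (\<kappa> x) * j (g x)) ^ Q)"
    unfolding b_def by (rule freshmans_dream_sum') (use char in auto)
  then have bQ: "b ^ Q - b = (\<Sum>x\<in>I. \<iota> (\<kappa> x) * j (g x ^ Q - g x))"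
    unfolding b_def using insert.hyps frob gi
    by (simp add: power_mult_distrib jD sum_subtractf right_diff_distrib)
  have "b ^ Q - b \<in> B"
    using Bdiff[OF Bpow[OF b, of "Q - 1"] b] Q by simp
  moreover have "\<forall>x\<in>I. c x = 0" if c: "(\<Sum>x\<in>I. e0 (c x) * (g x ^ Q - g x)) = 0" for c
  proof -
    define h where "h = (\<Sum>x\<in>I. e0 (c x) * g x)"
    have "h ^ Q = (\<Sum>x\<in>I. (e0 (c x) * g x) ^ Q)"
      unfolding h_def by (rule freshmans_dream_sum') (use char in auto)
    also have "\<dots> = h"
      using c unfolding h_def by (simp add: power_mult_distrib frob right_diff_distrib sum_subtractf)
    finally obtain a where a: "h = e0 a" using fixE by blast
    have "(\<Sum>x\<in>I. e0 (c x) * f x) = h * f i"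
      unfolding h_def sum_distrib_right g_def using fi by (intro sum.cong) auto
    moreover have "(\<Sum>x\<in>I. e0 (if x = i then - a else c x) * f x) = (\<Sum>x\<in>I. e0 (c x) * f x)"
      using insert.hyps by (intro sum.cong) auto
    ultimately have "(\<Sum>x\<in>insert i I. e0 (if x = i then - a else c x) * f x) = 0"
      using insert.hyps a by (simp add: eD)
    from insert.prems(1)[OF this] show ?thesis
      using insert.hyps(2) by (metis insertCI)
  qed
  ultimately have IH: "\<forall>x\<in>I. \<iota> (\<kappa> x) \<in> B"
    using insert.IH[of "\<lambda>x. g x ^ Q - g x"] bQ by simp
  have "0 \<in> B"
    using B(1) jD(1) by (metis rangeI subsetD)
  have "(\<Sum>x\<in>I. \<iota> (\<kappa> x) * j (g x)) \<in> B"
    using insert.hyps(1) IH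
  proof (induction I rule: finite_induct)
    case (insert x I)
    moreover have "j (g x) \<in> B" using B(1) by blast
    ultimately show ?case using B(2,3) by simp
  qed (use \<open>0 \<in> B\<close> in simp)
  then have "b - (\<Sum>x\<in>I. \<iota> (\<kappa> x) * j (g x)) \<in> B"
    using Bdiff b by blast
  then have "\<iota> (\<kappa> i) \<in> B"
    unfolding b_def using insert.hyps gi by (simp add: jD)
  with IH show ?case by blast
qed simp


text \<open>
  Intermediate rings of a constant field extension are themselves constant field extensions. A
  shortest expression of an element of \<open>B\<close> has independent \<open>f i\<close>, so the previous lemma applies.
\<close>
lemma intermediate_ring_spanned_by_constants:
  fixes j :: "'e::field \<Rightarrow> 'l::field" and \<iota> :: "'k::field \<Rightarrow> 'l" and e0 :: "'a::field \<Rightarrow> 'e"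
    and emb :: "'a \<Rightarrow> 'k"
  assumes emb: "field_embedding j" "field_embedding \<iota>" "field_embedding e0" "field_embedding emb"
    and square: "\<And>a. j (e0 a) = \<iota> (emb a)"
    and char: "prime CHAR('e)" "CHAR('l) = CHAR('e)" "Q = CHAR('e) ^ t"
    and frob: "\<And>x. \<iota> x ^ Q = \<iota> x" "\<And>a. e0 a ^ Q = e0 a" and fixE: "\<And>x. x ^ Q = x \<Longrightarrow> x \<in> range e0"
    and B: "range j \<subseteq> B" "\<And>x y. x \<in> B \<Longrightarrow> y \<in> B \<Longrightarrow> x + y \<in> B" "\<And>x y. x \<in> B \<Longrightarrow> y \<in> B \<Longrightarrow> x * y \<in> B"
  shows "\<lbrakk>finite I; (\<Sum>i\<in>I. \<iota> (\<kappa> i) * j (f i)) \<in> B\<rbrakk> \<Longrightarrow>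
    (\<Sum>i\<in>I. \<iota> (\<kappa> i) * j (f i)) \<in> module.span (restrict_scalars j (*)) (range \<iota> \<inter> B)"
proof (induction "card I" arbitrary: I \<kappa> rule: less_induct)
  case less
  note jD = field_embeddingD[OF emb(1)] and \<iota>D = field_embeddingD[OF emb(2)]
    and eD = field_embeddingD[OF emb(3)] and mD = field_embeddingD[OF emb(4)]
  interpret L: vector_space "restrict_scalars j ((*) :: 'l \<Rightarrow> _)"
    by (rule vector_space_restrict_scalars[OF _ emb(1)]) (unfold_locales, auto simp: algebra_simps)
  show ?case
  proof (cases "\<forall>c. (\<Sum>i\<in>I. e0 (c i) * f i) = 0 \<longrightarrow> (\<forall>i\<in>I. c i = 0)")
    case True
    then have "\<forall>i\<in>I. \<iota> (\<kappa> i) \<in> B"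
      using coefficients_in_intermediate_ring[OF emb(1-3) char frob fixE B less.prems(1) _ less.prems(2)]
      by blast
    then have "restrict_scalars j (*) (f i) (\<iota> (\<kappa> i)) \<in> L.span (range \<iota> \<inter> B)" if "i \<in> I" for i
      using that by (intro L.span_scale L.span_base) auto
    then show ?thesis
      by (intro L.span_sum) (auto simp: restrict_scalars_def mult.commute)
  next
    case False
    \<comment> \<open>a dependency among the \<open>f i\<close> allows eliminating one of them\<close>
    then obtain c i where c: "(\<Sum>x\<in>I. e0 (c x) * f x) = 0" and i: "i \<in> I" "c i \<noteq> 0"
      by blast
    let ?I = "I - {i}"
    have I: "I = insert i ?I" "finite ?I" "i \<notin> ?I"
      using i less.prems(1) by auto
    have "e0 (c i) * f i = - (\<Sum>x\<in>?I. e0 (c x) * f x)"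
      using c sum.insert[OF I(2,3), of "\<lambda>x. e0 (c x) * f x"] I(1)
      by (simp add: eq_neg_iff_add_eq_0)
    then have "f i = - (\<Sum>x\<in>?I. e0 (c x) * f x) / e0 (c i)"
      using i(2) by (simp add: eD field_simps)
    also have "\<dots> = - (\<Sum>x\<in>?I. e0 (c x / c i) * f x)"
      by (simp add: sum_divide_distrib eD)
    finally have "\<iota> (\<kappa> i) * j (f i) = - (\<Sum>x\<in>?I. \<iota> (emb (c x / c i) * \<kappa> i) * j (f x))"
      by (simp add: jD square \<iota>D sum_distrib_left mult.assoc mult.left_commute)
    then have "(\<Sum>x\<in>I. \<iota> (\<kappa> x) * j (f x)) =
        (\<Sum>x\<in>?I. \<iota> (\<kappa> x - emb (c x / c i) * \<kappa> i) * j (f x))"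
      using sum.insert[OF I(2,3), of "\<lambda>x. \<iota> (\<kappa> x) * j (f x)"] I(1)
      by (simp add: \<iota>D left_diff_distrib sum_subtractf)
    then show ?thesis
      using less.hyps[OF card_Diff1_less[OF less.prems(1) i(1)] I(2), of "\<lambda>x. \<kappa> x - emb (c x / c i) * \<kappa> i"]
        less.prems(2) by (simp only:)
  qed
qed


section \<open>Laurent series as an extension of the ground field\<close>

unbundle fps_syntax

definition map_fls :: "('a::zero \<Rightarrow> 'b::zero) \<Rightarrow> 'a fls \<Rightarrow> 'b fls" where
  "map_fls h f = Abs_fls (\<lambda>k. h (f $$ k))"

lemma map_fls_nth: "h 0 = 0 \<Longrightarrow> map_fls h f $$ k = h (f $$ k)"
  unfolding map_fls_def by (rule nth_Abs_fls_lower_bound[of "fls_subdegree f"]) simp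

lemma map_fls_const: "h 0 = 0 \<Longrightarrow> map_fls h (fls_const c) = fls_const (h c)"
  by (intro fls_eqI) (simp add: map_fls_nth)

lemma field_embedding_map_fls:
  assumes h: "field_embedding h"
  shows "field_embedding (map_fls h)"
proof -
  note hD = field_embeddingD[OF h]
  have sub: "fls_subdegree (map_fls h f) = fls_subdegree f" for f
  proof (cases "f = 0")
    case True
    then have "map_fls h f = 0" by (intro fls_eqI) (simp add: map_fls_nth hD(1))
    then show ?thesis using True by simp
  next
    case False
    then show ?thesis by (intro fls_subdegree_eqI) (simp_all add: map_fls_nth hD(1,8))
  qed
  show ?thesis
    unfolding field_embedding_def
  proof (intro conjI allI)
    show "map_fls h 1 = 1"
      by (intro fls_eqI) (simp add: map_fls_nth hD(1,2))
    show "map_fls h (f + g) = map_fls h f + map_fls h g" for f g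
      by (intro fls_eqI) (simp add: map_fls_nth hD)
    show "map_fls h (f * g) = map_fls h f * map_fls h g" for f g
      by (intro fls_eqI) (simp add: map_fls_nth hD fls_times_nth(1) sub)
  qed
qed

lemma field_embedding_fls_const: "field_embedding (fls_const :: 'f::field \<Rightarrow> 'f fls)"
  by (simp add: field_embedding_def fls_plus_const flip: fls_const_mult_const)


lemma infinite_UNIV_fls: "infinite (UNIV :: 'f::field fls set)"
proof
  assume "finite (UNIV :: 'f fls set)"
  moreover have "inj (\<lambda>k::nat. (fls_X :: 'f fls) ^ k)"
    by (rule inj_on_inverseI[where g = "\<lambda>f. nat (fls_subdegree f)"]) simp
  ultimately show False
    using finite_subset[of "range (\<lambda>k::nat. (fls_X :: 'f fls) ^ k)" UNIV] range_inj_infinite by blast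
qed

text \<open>The constants already exhaust the roots that \<open>x ^ Q = x\<close> can have in a field.\<close>
lemma fls_frobenius_fixed_is_const:
  fixes f :: "'k::{field,finite} fls"
  assumes "f ^ CARD('k) = f"
  shows "f \<in> range fls_const"
proof -
  let ?F = "{f :: 'k fls. f ^ CARD('k) = f}"
  have two: "CARD('k) \<ge> 2"
    using card_mono[of UNIV "{0, 1 :: 'k}"] by simp
  have "c ^ CARD('k) = c" for c :: 'k
    using is_subfield_power_card[OF is_subfield_UNIV, of c] by simp
  then have "range fls_const \<subseteq> ?F"
    by (auto simp flip: field_embeddingD(10)[OF field_embedding_fls_const])
  moreover have "card (range (fls_const :: 'k \<Rightarrow> 'k fls)) = CARD('k)"
    by (rule card_image[OF field_embeddingD(11)[OF field_embedding_fls_const]])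
  ultimately have "range fls_const = ?F"
    using card_frobenius_fixed_le[OF two, where ?'f = "'k fls"] by (intro card_seteq) auto
  then show ?thesis using assms by blast
qed

lemma sum_fun_apply: "sum F I x = (\<Sum>i\<in>I. F i x)"
  by (induction I rule: infinite_finite_induct) auto

section \<open>Finite spans\<close>

lemma (in vector_space) card_span_independent:
  assumes "finite (UNIV :: 'a set)" "finite B" "independent B"
  shows "finite (span B) \<and> card (span B) = CARD('a) ^ card B"
  using assms(2,3)
proof (induction B)
  case (insert b B)
  have b: "b \<notin> span B" "independent B"
    using insert.prems insert.hyps by (auto simp: independent_insert)
  let ?f = "\<lambda>(c, y). scale c b + y"
  have "inj_on ?f (UNIV \<times> span B)"
  proof (rule inj_onI, clarify)
    fix c c' y y' assume y: "y \<in> span B" "y' \<in> span B" and eq: "scale c b + y = scale c' b + y'"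
    then have "scale (c - c') b = y' - y"
      by (simp add: scale_left_diff_distrib algebra_simps)
    then have "scale (c - c') b \<in> span B"
      using y span_diff by simp
    then have "scale (inverse (c - c')) (scale (c - c') b) \<in> span B"
      by (rule span_scale)
    then have "c = c'"
      using b(1) by (cases "c = c'") auto
    then show "c = c' \<and> y = y'" using eq by simp
  qed
  moreover have "?f ` (UNIV \<times> span B) = span (insert b B)"
  proof (intro equalityI subsetI)
    fix x assume "x \<in> span (insert b B)"
    then obtain c where "x - scale c b \<in> span B" by (auto simp: span_breakdown_eq)
    then show "x \<in> ?f ` (UNIV \<times> span B)"
      by (intro image_eqI[of _ _ "(c, x - scale c b)"]) auto
  next
    fix x assume "x \<in> ?f ` (UNIV \<times> span B)"
    then show "x \<in> span (insert b B)"
      using span_mono[of B "insert b B"] by (auto intro!: span_add span_scale intro: span_base)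
  qed
  ultimately have "bij_betw ?f (UNIV \<times> span B) (span (insert b B))"
    by (simp add: bij_betw_def)
  then show ?case
    using insert.IH b(2) insert.hyps assms(1) bij_betw_same_card[of ?f] bij_betw_finite[of ?f]
    by (metis card_cartesian_product card_insert_disjoint finite_cartesian_product power_Suc)
qed simp

lemma span_over_finite:
  assumes "module scale" "finite S" "0 \<in> K"
  shows "span_over scale K S = {\<Sum>v\<in>S. scale (c v) v | c. range c \<subseteq> K}"
proof -
  interpret module scale by fact
  have "\<exists>c'. (\<Sum>v\<in>T. scale (c v) v) = (\<Sum>v\<in>S. scale (c' v) v) \<and> range c' \<subseteq> K"
    if "T \<subseteq> S" "c ` T \<subseteq> K" for T c
    using that assms(2,3)
    by (intro exI[of _ "\<lambda>v. if v \<in> T then c v else 0"] conjI sum.mono_neutral_cong_left) auto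
  then show ?thesis
    using assms(2) unfolding span_over_def by blast
qed

lemma subset_span_over:
  assumes "module scale" "1 \<in> K"
  shows "S \<subseteq> span_over scale K S"
proof
  interpret module scale by fact
  fix v assume v: "v \<in> S"
  have "v = (\<Sum>x\<in>{v}. scale 1 x)" by simp
  then show "v \<in> span_over scale K S"
    unfolding span_over_def using v assms(2)
    by (intro CollectI exI[of _ "{v}"] exI[of _ "\<lambda>_. 1"]) auto
qed

section \<open>Weights after extension of scalars\<close>

definition coordscale :: "'l::times \<Rightarrow> ('b \<Rightarrow> 'l) \<Rightarrow> 'b \<Rightarrow> 'l" where
  "coordscale c f = (\<lambda>b. c * f b)"

text \<open>
  The basis \<open>Bs\<close> of the ambient space serves to extend scalars in coordinates.
\<close>

locale linear_set_setting = vector_space scale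
  for scale :: "'k::{field,finite} \<Rightarrow> 'v::ab_group_add \<Rightarrow> 'v" +
  fixes emb :: "'a::{field,finite} \<Rightarrow> 'k" and Bs :: "'v set" and U :: "'v set" and n m w :: nat
  assumes emb: "field_embedding emb"
    and Bs: "independent Bs" "span Bs = UNIV"
    and U: "module.subspace (restrict_scalars emb scale) U"
    and dimU: "vector_space.dim (restrict_scalars emb scale) U = m" and m: "m \<ge> 1"
    and primepow_q: "primepow CARD('a)" and cardK: "CARD('k) = CARD('a) ^ n"
    and n_le: "n \<le> CARD('a)" and w: "w \<ge> 2"
    and weight: "\<And>P. P \<in> linear_set scale U \<Longrightarrow> w \<le> point_weight emb scale U P"
begin

abbreviation "j \<equiv> map_fls emb"

text \<open>
  Coordinate vectors of Laurent series realise the ambient space with scalars extended from \<open>'k\<close> to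
  \<open>'k fls\<close>, and \<open>\<Phi>\<close> embeds the original space as the constant vectors.
\<close>

definition \<Phi> :: "'v \<Rightarrow> 'v \<Rightarrow> 'k fls" where
  "\<Phi> v = (\<lambda>b. fls_const (representation Bs v b))"

sublocale F: vector_space "restrict_scalars emb scale"
  by (rule vector_space_restrict_scalars[OF vector_space_axioms emb])

sublocale K: vector_space "restrict_scalars emb (*)"
  by (rule vector_space_restrict_scalars[OF _ emb]) (unfold_locales, auto simp: algebra_simps)

sublocale X: scalar_extension "coordscale :: 'k fls \<Rightarrow> ('v \<Rightarrow> 'k fls) \<Rightarrow> _" j
  by unfold_locales (auto simp: coordscale_def algebra_simps fun_eq_iff field_embedding_map_fls[OF emb])

lemmas embD = field_embeddingD[OF emb]
lemmas constD = field_embeddingD[OF field_embedding_fls_const]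

lemma j_const: "j (fls_const a) = fls_const (emb a)"
  by (simp add: map_fls_const embD)

lemma rep_lin: "representation Bs (u + v) b = representation Bs u b + representation Bs v b"
    "representation Bs (scale c v) b = c * representation Bs v b"
    "representation Bs 0 b = 0"
  using Bs by (auto simp: representation_add representation_scale representation_zero)

lemma rep_sum: "representation Bs (sum f I) b = (\<Sum>i\<in>I. representation Bs (f i) b)"
  by (induction I rule: infinite_finite_induct) (auto simp: rep_lin)

lemma rep_eq_0: "(\<And>b. representation Bs v b = 0) \<Longrightarrow> v = 0"
  using sum_nonzero_representation_eq[OF Bs(1), of v] Bs(2) by simp

lemma \<Phi>_add: "\<Phi> (u + v) = \<Phi> u + \<Phi> v"
  and \<Phi>_scale: "\<Phi> (scale c v) = coordscale (fls_const c) (\<Phi> v)"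
  and \<Phi>_0: "\<Phi> 0 = 0"
  by (auto simp: \<Phi>_def coordscale_def rep_lin fun_eq_iff fls_plus_const)

lemma \<Phi>_sum: "\<Phi> (sum f I) = (\<Sum>i\<in>I. \<Phi> (f i))"
  by (induction I rule: infinite_finite_induct) (auto simp: \<Phi>_add \<Phi>_0)

lemma \<Phi>_restrict_scale: "\<Phi> (restrict_scalars emb scale a v) = X.sE (fls_const a) (\<Phi> v)"
  by (simp add: restrict_scalars_def \<Phi>_scale j_const)

lemma \<Phi>_eq_0: "\<Phi> v = 0 \<Longrightarrow> v = 0"
  by (rule rep_eq_0) (auto simp: \<Phi>_def fun_eq_iff constD(8))

lemma inj_\<Phi>: "inj \<Phi>"
proof (rule injI)
  fix u v assume "\<Phi> u = \<Phi> v"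
  moreover have "\<Phi> u = \<Phi> (u - v) + \<Phi> v"
    using \<Phi>_add[of "u - v" v] by simp
  ultimately show "u = v"
    using \<Phi>_eq_0[of "u - v"] by simp
qed

text \<open>
  Extending scalars preserves independence: a relation with Laurent series as coefficients holds for
  the coefficients of each power of the variable separately.
\<close>

lemma \<Phi>_independent:
  assumes "finite A" "F.independent A"
  shows "X.E.independent (\<Phi> ` A)"
proof (rule X.E.independent_if_scalars_zero)
  show "finite (\<Phi> ` A)" using assms by simp
  fix f y assume sum0: "(\<Sum>y\<in>\<Phi> ` A. X.sE (f y) y) = 0" and y: "y \<in> \<Phi> ` A"
  then have 0: "(\<Sum>v\<in>A. X.sE (f (\<Phi> v)) (\<Phi> v)) = 0"
    by (simp add: sum.reindex[OF inj_on_subset[OF inj_\<Phi> subset_UNIV]])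
  obtain v where v: "v \<in> A" "y = \<Phi> v" using y by auto
  have "f (\<Phi> v) $$ k = 0" for k
  proof -
    have "representation Bs (\<Sum>v\<in>A. restrict_scalars emb scale (f (\<Phi> v) $$ k) v) b = 0" for b
    proof -
      have "0 = (\<Sum>v\<in>A. X.sE (f (\<Phi> v)) (\<Phi> v)) b $$ k"
        by (simp add: 0)
      also have "\<dots> = (\<Sum>v\<in>A. emb (f (\<Phi> v) $$ k) * representation Bs v b)"
        by (simp add: sum_fun_apply fls_nth_sum restrict_scalars_def coordscale_def \<Phi>_def map_fls_nth embD)
      finally show ?thesis
        by (simp add: rep_sum restrict_scalars_def rep_lin)
    qed
    then have "(\<Sum>v\<in>A. restrict_scalars emb scale (f (\<Phi> v) $$ k) v) = 0"
      by (rule rep_eq_0)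
    then show ?thesis
      using F.independentD[OF assms(2,1) subset_refl _ v(1), of "\<lambda>v. f (\<Phi> v) $$ k"] by simp
  qed
  then show "f y = 0"
    using v(2) by (intro fls_eqI) simp
qed

lemma const_independent:
  assumes "finite A" "K.independent A"
  shows "X.L.independent (fls_const ` A)"
proof (rule X.L.independent_if_scalars_zero)
  show "finite (fls_const ` A)" using assms by simp
  fix f y assume sum0: "(\<Sum>y\<in>fls_const ` A. X.mE (f y) y) = 0" and y: "y \<in> fls_const ` A"
  then have 0: "(\<Sum>v\<in>A. X.mE (f (fls_const v)) (fls_const v)) = 0"
    by (simp add: sum.reindex[OF inj_on_subset[OF constD(11) subset_UNIV]])
  obtain v where v: "v \<in> A" "y = fls_const v" using y by auto
  have "f (fls_const v) $$ k = 0" for k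
  proof -
    have "0 = (\<Sum>v\<in>A. X.mE (f (fls_const v)) (fls_const v)) $$ k"
      by (simp add: 0)
    also have "\<dots> = (\<Sum>v\<in>A. restrict_scalars emb (*) (f (fls_const v) $$ k) v)"
      by (simp add: fls_nth_sum restrict_scalars_def map_fls_nth embD)
    finally show ?thesis
      using K.independentD[OF assms(2,1) subset_refl _ v(1), of "\<lambda>v. f (fls_const v) $$ k"] by simp
  qed
  then show "f y = 0"
    using v(2) by (intro fls_eqI) simp
qed

lemma \<Phi>_span: "v \<in> F.span A \<Longrightarrow> \<Phi> v \<in> X.E.span (\<Phi> ` A)"
proof (induction rule: F.span_induct_alt)
  case base
  show ?case unfolding \<Phi>_0 by (rule X.E.span_zero)
next
  case (step a x y)
  have "X.sE (fls_const a) (\<Phi> x) \<in> X.E.span (\<Phi> ` A)"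
    using step(1) by (intro X.E.span_scale X.E.span_base) blast
  then show ?case
    unfolding \<Phi>_add \<Phi>_restrict_scale using step(2) by (rule X.E.span_add)
qed

lemma const_span: "c \<in> K.span A \<Longrightarrow> fls_const c \<in> X.L.span (fls_const ` A)"
proof (induction rule: K.span_induct_alt)
  case (step a x y)
  have "fls_const (restrict_scalars emb (*) a x + y) = X.mE (fls_const a) (fls_const x) + fls_const y"
    by (simp add: restrict_scalars_def j_const fls_plus_const)
  moreover have "X.mE (fls_const a) (fls_const x) \<in> X.L.span (fls_const ` A)"
    using step(1) by (intro X.L.span_scale X.L.span_base) blast
  ultimately show ?case
    using step(2) X.L.span_add by metis
qed (simp add: X.L.span_zero)

lemma two_le_q: "2 \<le> CARD('a)"
  using card_mono[of UNIV "{0, 1 :: 'a}"] by simp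

lemma K_basis:
  obtains Kb where "K.independent Kb" "K.span Kb = UNIV" "card Kb = n"
proof -
  obtain Kb where Kb: "K.independent Kb" "UNIV \<subseteq> K.span Kb"
    using K.maximal_independent_subset[of UNIV] by auto
  then have "CARD('k) = CARD('a) ^ card Kb"
    using K.card_span_independent[of Kb] by (simp add: top.extremum_unique)
  then have "card Kb = n"
    using cardK two_le_q by simp
  with Kb that show thesis by blast
qed

lemma laurent_expansion:
  assumes Kb: "K.independent Kb" "K.span Kb = UNIV"
  shows "\<exists>f. x = (\<Sum>i\<in>Kb. fls_const i * j (f i))"
proof -
  define f where "f i = Abs_fls (\<lambda>k. K.representation Kb (x $$ k) i)" for i
  have f: "f i $$ k = K.representation Kb (x $$ k) i" for i k
    unfolding f_def by (rule nth_Abs_fls_lower_bound[of "fls_subdegree x"]) (simp add: K.representation_zero)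
  have "x $$ k = (\<Sum>i\<in>Kb. fls_const i * j (f i)) $$ k" for k
    using K.sum_representation_eq[OF Kb(1), of "x $$ k" Kb] Kb(2)
    by (simp add: fls_nth_sum map_fls_nth embD f restrict_scalars_def mult.commute)
  then show ?thesis by (intro exI[of _ f] fls_eqI) blast
qed

lemma L_spanning:
  assumes Kb: "K.independent Kb" "K.span Kb = UNIV"
  shows "x \<in> X.L.span (fls_const ` Kb)"
proof -
  obtain f where "x = (\<Sum>i\<in>Kb. fls_const i * j (f i))"
    using laurent_expansion[OF assms] by blast
  then have "x = (\<Sum>i\<in>Kb. X.mE (f i) (fls_const i))"
    by (simp add: restrict_scalars_def mult.commute)
  then show ?thesis
    using X.L.span_sum[of Kb "\<lambda>i. X.mE (f i) (fls_const i)"]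
    by (simp add: X.L.span_scale X.L.span_base)
qed

lemma card_independent_le_n:
  assumes "X.L.independent A"
  shows "card A \<le> n"
proof -
  obtain Kb where Kb: "K.independent Kb" "K.span Kb = UNIV" "card Kb = n"
    by (rule K_basis)
  have "card A \<le> card (fls_const ` Kb)"
    using X.L.independent_span_bound[OF _ assms, of "fls_const ` Kb"] L_spanning[OF Kb(1,2)] by auto
  also have "\<dots> \<le> n"
    using card_image_le[of Kb fls_const] Kb(3) by simp
  finally show ?thesis .
qed

lemma U_basis:
  obtains B where "F.independent B" "F.span B = U" "card B = m" "finite B"
proof -
  obtain B where B: "B \<subseteq> U" "F.independent B" "U \<subseteq> F.span B" "card B = m"
    using F.basis_exists[of U] dimU by auto
  moreover have "F.span B = U"
    using B U by (metis F.span_minimal subset_antisym)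
  moreover have "finite B" using B(4) m by (metis card.infinite not_one_le_zero)
  ultimately show thesis using that by blast
qed

lemma finite_U: "finite U" and card_U: "card U = CARD('a) ^ m"
  by (rule U_basis, metis F.card_span_independent finite)+

text \<open>The extension of scalars of an \<open>'a\<close>-subspace.\<close>

definition ext :: "'v set \<Rightarrow> ('v \<Rightarrow> 'k fls) set" where
  "ext A = X.E.span (\<Phi> ` A)"

lemma subspace_ext: "X.E.subspace (ext A)"
  by (simp add: ext_def X.E.subspace_span)

lemma in_ext: "v \<in> A \<Longrightarrow> \<Phi> v \<in> ext A"
  by (simp add: ext_def X.E.span_base)

text \<open>
  For a constant vector, the scalars in \<open>'k\<close> that witness its weight stay independent over the
  Laurent series and span a space meeting that of a free set trivially.
\<close>

lemma weight_rational:
  assumes v: "v \<in> U" "v \<noteq> 0" and free: "X.free_at Y (\<Phi> v) (ext U)"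
  shows "card Y + w \<le> n"
proof -
  have "span {v} \<in> linear_set scale U"
    using v by (auto simp: linear_set_def)
  then have w': "w \<le> F.dim (span {v} \<inter> U)"
    using weight by (simp add: point_weight_def)
  obtain C where C: "C \<subseteq> span {v} \<inter> U" "F.independent C" "card C = F.dim (span {v} \<inter> U)"
    using F.basis_exists by metis
  have finC: "finite C" using C(1) finite_U finite_subset by blast
  have "\<forall>c\<in>C. \<exists>k. c = scale k v"
    using C(1) by (auto simp: span_singleton)
  then obtain k where k: "\<forall>c\<in>C. c = scale (k c) v"
    by (rule bchoice[THEN exE])
  have injk: "inj_on k C" using k by (metis inj_onI)
  have "K.independent (k ` C)"
  proof (rule K.independent_if_scalars_zero)
    fix f x assume "(\<Sum>x\<in>k ` C. restrict_scalars emb (*) (f x) x) = 0" and x: "x \<in> k ` C"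
    then have "0 = scale (\<Sum>c\<in>C. emb (f (k c)) * k c) v"
      by (simp add: sum.reindex[OF injk] restrict_scalars_def)
    also have "\<dots> = (\<Sum>c\<in>C. restrict_scalars emb scale (f (k c)) c)"
      unfolding scale_sum_left restrict_scalars_def using k
      by (intro sum.cong refl) (metis scale_scale)
    finally have 0: "(\<Sum>c\<in>C. restrict_scalars emb scale (f (k c)) c) = 0" by simp
    obtain c where "c \<in> C" "x = k c" using x by auto
    then show "f x = 0"
      using F.independentD[OF C(2) finC subset_refl 0] by simp
  qed (use finC in simp)
  then have ind: "X.L.independent (fls_const ` k ` C)"
    using const_independent finC by blast
  define D where "D = (fls_const ` k ` C :: 'k fls set)"
  have "coordscale x (\<Phi> v) \<in> ext U" if "x \<in> X.L.span D" for x
  proof -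
    have "x \<in> {x. coordscale x (\<Phi> v) \<in> ext U}"
    proof (rule X.L.span_minimal[THEN subsetD, OF _ _ that])
      show "D \<subseteq> {x. coordscale x (\<Phi> v) \<in> ext U}"
        using C(1) k in_ext unfolding D_def by (auto simp flip: \<Phi>_scale)
      show "X.L.subspace {x. coordscale x (\<Phi> v) \<in> ext U}"
        by (rule X.LE.linear_subspace_linear_preimage[OF X.linear_orbit subspace_ext])
    qed
    then show ?thesis by simp
  qed
  then have disj: "x = 0" if "x \<in> X.L.span Y" "x \<in> X.L.span D" for x
    using free that unfolding X.free_at_def by blast
  have Y: "finite Y" "X.L.independent Y"
    using free by (auto simp: X.free_at_def)
  have "X.L.independent (Y \<union> D)"
    using X.L.independent_Un[OF Y _ disj] ind by (simp add: D_def)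
  then have "card (Y \<union> D) \<le> n" by (rule card_independent_le_n)
  moreover have "Y \<inter> D = {}"
    using disj Y(2) X.L.dependent_zero X.L.span_base by (metis disjoint_iff)
  moreover have "card D = card C"
    unfolding D_def using injk by (simp add: card_image inj_on_subset[OF constD(11) subset_UNIV])
  ultimately show ?thesis
    using Y(1) finC w' C(3) card_Un_disjoint[of Y D] by (simp add: D_def)
qed

text \<open>
  The lower bound on the weights survives the extension of scalars. This is where \<open>n \<le> q\<close> enters: a
  free set violating the bound can be taken of size \<open>n + 1 - w \<le> n - 1 < q\<close>, as \<open>w \<ge> 2\<close>, so the
  coefficients of \<open>v\<close> can be replaced by elements of the field with \<open>q\<close> elements, contradicting the bound for a
  constant vector.
\<close>

lemma weight_generic:
  assumes v: "v \<in> ext U" and free: "X.free_at Y v (ext U)"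
  shows "card Y + w \<le> n"
proof (rule ccontr)
  assume "\<not> card Y + w \<le> n"
  obtain v0 where v0: "v0 \<in> U" "v0 \<noteq> 0"
  proof -
    have "1 < card U" using card_U two_le_q m one_less_power[of "CARD('a)" m] by simp
    then have "\<not> U \<subseteq> {0}" using card_mono[of "{0}" U] by auto
    then show thesis using that by blast
  qed
  have "X.free_at {} (\<Phi> v0) (ext U)"
    by (simp add: X.free_at_def X.L.independent_empty)
  then have wn: "w \<le> n" using weight_rational[OF v0, of "{}"] by simp
  have "n + 1 - w \<le> card Y" using \<open>\<not> card Y + w \<le> n\<close> by simp
  then obtain Z where Z: "Z \<subseteq> Y" "card Z = n + 1 - w"
    by (rule obtain_subset_with_card_n)
  have freeZ: "X.free_at Z v (ext U)" by (rule X.free_at_subset[OF free Z(1)])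
  obtain d where d: "v = (\<Sum>b\<in>\<Phi> ` U. X.sE (d b) b)"
    using v finite_U by (auto simp: ext_def X.E.span_finite)
  have "card (range (fls_const :: 'a \<Rightarrow> 'a fls)) = CARD('a)"
    by (rule card_image[OF constD(11)])
  then have "card Z < card (range (fls_const :: 'a \<Rightarrow> 'a fls))"
    using Z(2) w wn n_le by simp
  then have "\<exists>c. range c \<subseteq> range (fls_const :: 'a \<Rightarrow> 'a fls) \<and>
      X.free_at Z (0 + (\<Sum>b\<in>\<Phi> ` U. X.sE (c b) b)) (ext U)"
    by (rule X.free_at_specialise[OF subspace_ext, where d = d, rotated])
       (use finite_U freeZ d in auto)
  then obtain c where c: "range c \<subseteq> range (fls_const :: 'a \<Rightarrow> 'a fls)"
      "X.free_at Z (0 + (\<Sum>b\<in>\<Phi> ` U. X.sE (c b) b)) (ext U)"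
    by blast
  have "\<forall>b. \<exists>a. c b = fls_const a" using c(1) by blast
  then obtain a where a: "\<And>b. c b = fls_const (a b)" by metis
  define v1 where "v1 = (\<Sum>x\<in>U. restrict_scalars emb scale (a (\<Phi> x)) x)"
  have "v1 \<in> U"
    unfolding v1_def by (intro F.subspace_sum[OF U] F.subspace_scale[OF U])
  have "(\<Sum>b\<in>\<Phi> ` U. X.sE (c b) b) = \<Phi> v1"
    using sum.reindex[OF inj_on_subset[OF inj_\<Phi> subset_UNIV[of U]]]
    by (simp add: v1_def \<Phi>_sum \<Phi>_restrict_scale a)
  then have free1: "X.free_at Z (\<Phi> v1) (ext U)" using c(2) by simp
  \<comment> \<open>\<open>Z\<close> is nonempty, and no nonempty set is free at zero\<close>
  have "v1 \<noteq> 0"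
  proof
    assume "v1 = 0"
    obtain x where x: "x \<in> Z" using Z(2) wn by fastforce
    have "coordscale x (\<Phi> v1) \<in> ext U"
      using X.E.subspace_0[OF subspace_ext] \<open>v1 = 0\<close> by (simp add: \<Phi>_0)
    then have "x = 0"
      using free1 X.L.span_base[OF x] by (simp add: X.free_at_def)
    then show False
      using free1 x X.L.dependent_zero by (auto simp: X.free_at_def)
  qed
  then show False
    using weight_rational[OF \<open>v1 \<in> U\<close> _ free1] Z(2) wn by simp
qed


section \<open>The field of linearity\<close>

lemma laurent_subring_spanned_by_constants:
  assumes "range j \<subseteq> B" "\<And>x y. x \<in> B \<Longrightarrow> y \<in> B \<Longrightarrow> x + y \<in> B" "\<And>x y. x \<in> B \<Longrightarrow> y \<in> B \<Longrightarrow> x * y \<in> B"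
    and b: "b \<in> B"
  shows "b \<in> X.L.span (range fls_const \<inter> B)"
proof -
  obtain t where t: "CARD('a) = CHAR('a) ^ t"
    using CHAR_prime_power_card[OF primepow_q] by blast
  have char: "CHAR('a fls) = CHAR('a)" "CHAR('k fls) = CHAR('a fls)"
    using field_embedding_CHAR field_embedding_fls_const field_embedding_map_fls[OF emb] by metis+
  have frob: "fls_const x ^ CARD('k) = fls_const x" for x :: 'k
    using is_subfield_power_card[OF is_subfield_UNIV, of x] by (simp flip: constD(10))
  have "a ^ CARD('a) = a" for a :: 'a
    using is_subfield_power_card[OF is_subfield_UNIV, of a] by simp
  then have frob_a: "a ^ CARD('k) = a" for a :: 'a
    unfolding cardK by (induction n) (simp_all add: power_mult)
  then have frob': "fls_const a ^ CARD('k) = fls_const a" for a :: 'a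
    by (simp flip: constD(10))
  have fixE: "x \<in> range fls_const" if "x ^ CARD('k) = x" for x :: "'a fls"
  proof -
    have "j x ^ CARD('k) = j x"
      using that by (simp flip: X.j_simps(10))
    then obtain c where c: "j x = fls_const c"
      using fls_frobenius_fixed_is_const by blast
    have "emb (x $$ k) = 0" if "k \<noteq> 0" for k
      using arg_cong[OF c, of "\<lambda>f. f $$ k"] that by (simp add: map_fls_nth embD)
    then have "x = fls_const (x $$ 0)"
      by (intro fls_eqI) (auto simp: embD)
    then show ?thesis by blast
  qed
  obtain Kb where Kb: "K.independent Kb" "K.span Kb = UNIV"
    using K_basis by blast
  obtain f where f: "b = (\<Sum>i\<in>Kb. fls_const i * j (f i))"
    using laurent_expansion[OF Kb] by blast
  have Q: "CARD('k) = CHAR('a fls) ^ (t * n)"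
    by (simp add: cardK t char power_mult)
  have "prime CHAR('a fls)"
    using CHAR_prime_power_card(1)[OF primepow_q] char by simp
  from intermediate_ring_spanned_by_constants[OF X.embedding field_embedding_fls_const
      field_embedding_fls_const emb j_const this char(2) Q frob frob' fixE assms(1-3), of Kb "\<lambda>i. i" f]
  show ?thesis
    using b f by simp
qed

lemma constants_subfield:
  assumes B: "range j \<subseteq> B" "\<And>x y. x \<in> B \<Longrightarrow> y \<in> B \<Longrightarrow> x + y \<in> B" "\<And>x y. x \<in> B \<Longrightarrow> y \<in> B \<Longrightarrow> x * y \<in> B"
  defines "D \<equiv> {\<kappa>. fls_const \<kappa> \<in> B}"
  shows "is_subfield D" and "range emb \<subseteq> D" and "\<And>x y. x \<in> D \<Longrightarrow> y \<in> D \<Longrightarrow> x + y \<in> D"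
proof -
  have embD': "emb a \<in> D" for a
    using B(1) by (auto simp: D_def simp flip: j_const)
  then show "range emb \<subseteq> D" by blast
  have D_1: "1 \<in> D" and D_0: "0 \<in> D"
    using embD'[of 1] embD'[of 0] by (simp_all add: embD)
  show D_add: "x + y \<in> D" if "x \<in> D" "y \<in> D" for x y
    using that B(2) by (simp add: D_def flip: fls_plus_const)
  have D_mult: "x * y \<in> D" if "x \<in> D" "y \<in> D" for x y
    using that B(3) by (simp add: D_def flip: fls_const_mult_const)
  have D_pow: "x ^ i \<in> D" if "x \<in> D" for x i
    by (induction i) (auto simp: D_1 D_mult that)
  show "is_subfield D"
    unfolding is_subfield_def
  proof (intro conjI ballI impI)
    show "x - y \<in> D" if "x \<in> D" "y \<in> D" for x y
    proof -
      have "emb (- 1) * y \<in> D" using D_mult embD' that by blast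
      from D_add[OF that(1) this] show ?thesis by (simp add: embD)
    qed
    show "inverse x \<in> D" if "x \<in> D" "x \<noteq> 0" for x
    proof -
      have two: "2 \<le> CARD('k)" using card_mono[of UNIV "{0, 1 :: 'k}"] by simp
      have "x ^ Suc (Suc (CARD('k) - 2)) = x"
        using is_subfield_power_card[OF is_subfield_UNIV, of x] two by (simp add: Suc_diff_Suc numeral_2_eq_2)
      then have "x ^ (CARD('k) - 2) = inverse x"
        using that(2) by (simp add: field_simps)
      then show ?thesis using D_pow[OF that(1)] by metis
    qed
  qed (use D_0 D_1 D_mult in auto)
qed

lemma constants_basis:
  assumes B: "range j \<subseteq> B" "\<And>x y. x \<in> B \<Longrightarrow> y \<in> B \<Longrightarrow> x + y \<in> B" "\<And>x y. x \<in> B \<Longrightarrow> y \<in> B \<Longrightarrow> x * y \<in> B"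
  defines "D \<equiv> {\<kappa>. fls_const \<kappa> \<in> B}"
  obtains Db where "1 \<in> Db" "card D = CARD('a) ^ card Db" "B \<subseteq> X.L.span (fls_const ` Db)"
proof -
  note D = constants_subfield[OF B, folded D_def]
  have "K.subspace D"
    by (rule K.subspaceI)
       (use D range_subsetD[OF D(2)] in \<open>auto simp: is_subfield_def restrict_scalars_def\<close>)
  moreover have "K.independent {1}"
    by (simp add: K.dependent_single)
  then obtain Db where Db: "1 \<in> Db" "Db \<subseteq> D" "K.independent Db" "D \<subseteq> K.span Db"
    using K.maximal_independent_subset_extend[of "{1}" D] D(1) by (auto simp: is_subfield_def)
  ultimately have spanDb: "K.span Db = D"
    by (metis K.span_minimal subset_antisym)
  have "card D = CARD('a) ^ card Db"
    using K.card_span_independent[OF _ _ Db(3)] spanDb by simp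
  moreover have "B \<subseteq> X.L.span (fls_const ` Db)"
  proof
    fix b assume "b \<in> B"
    then have "b \<in> X.L.span (range fls_const \<inter> B)"
      using laurent_subring_spanned_by_constants[of B b] B by blast
    moreover have "range fls_const \<inter> B \<subseteq> X.L.span (fls_const ` Db)"
      using const_span[of _ Db] spanDb by (auto simp: D_def)
    ultimately show "b \<in> X.L.span (fls_const ` Db)"
      using X.L.span_minimal[OF _ X.L.subspace_span] by blast
  qed
  ultimately show thesis using that Db(1) by blast
qed

text \<open>
  A largest free set together with the scalars that keep \<open>u\<close> in \<open>ext U\<close> spans all Laurent series, so
  the bound \<open>card Y + w \<le> n\<close> on the free set \<open>Y\<close> forces \<open>A\<close> to be large.
\<close>

lemma weight_le_card_multipliers:
  assumes u: "u \<in> ext U" "X.generic (ext U) (ext U) u" and A: "finite A"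
    and mult: "\<And>\<alpha>. coordscale \<alpha> u \<in> ext U \<Longrightarrow> \<alpha> \<in> X.L.span A"
  shows "w \<le> card A"
proof -
  obtain Y where Y: "X.free_at Y u (ext U)"
      and max: "\<And>v Z. v \<in> ext U \<Longrightarrow> X.free_at Z v (ext U) \<Longrightarrow> card Z \<le> card Y"
    using u(2) by (auto simp: X.generic_def)
  have fin: "finite Y" using Y by (simp add: X.free_at_def)
  have span: "\<beta> \<in> X.L.span (Y \<union> A)" for \<beta>
  proof -
    have "\<exists>x\<in>X.L.span Y. coordscale (\<beta> - x) u \<in> ext U"
    proof (rule ccontr)
      assume no: "\<not> ?thesis"
      then have "X.free_at (insert \<beta> Y) u (ext U)"
        by (intro X.free_at_insert[OF Y subspace_ext]) blast
      then have "card (insert \<beta> Y) \<le> card Y" using max u by blast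
      then have "\<beta> \<in> Y" using fin by (metis card_insert_disjoint not_less_eq_eq order_refl)
      moreover have "coordscale (\<beta> - \<beta>) u \<in> ext U"
        using X.E.subspace_0[OF subspace_ext] by simp
      ultimately show False using no X.L.span_base by blast
    qed
    then obtain x where x: "x \<in> X.L.span Y" "coordscale (\<beta> - x) u \<in> ext U" by blast
    then have "x + (\<beta> - x) \<in> X.L.span (Y \<union> A)"
      using mult[OF x(2)] X.L.span_mono[of Y "Y \<union> A"] X.L.span_mono[of A "Y \<union> A"]
      by (intro X.L.span_add) auto
    then show ?thesis by simp
  qed
  obtain Kb where Kb: "K.independent Kb" "K.span Kb = UNIV" "card Kb = n"
    by (rule K_basis)
  have "n = card (fls_const ` Kb)"
    using Kb(3) by (simp add: card_image inj_on_subset[OF constD(11) subset_UNIV])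
  also have "\<dots> \<le> card (Y \<union> A)"
    using X.L.independent_span_bound[OF _ const_independent[OF _ Kb(1)]] fin A span
    by (metis finite finite_UnI subsetI)
  also have "\<dots> \<le> card Y + card A"
    by (rule card_Un_le)
  finally show ?thesis
    using weight_generic[OF u(1) Y] by simp
qed

lemma span_over_subspace_finite:
  assumes D: "is_subfield D" "range emb \<subseteq> D" "\<And>x y. x \<in> D \<Longrightarrow> y \<in> D \<Longrightarrow> x + y \<in> D"
  shows "F.subspace (span_over scale D U)" "finite (span_over scale D U)"
    and "span_over scale D U = {\<Sum>v\<in>U. scale (c v) v | c. range c \<subseteq> D}"
proof -
  let ?U' = "span_over scale D U"
  have D01: "0 \<in> D" "1 \<in> D" and D_mult: "\<And>x y. x \<in> D \<Longrightarrow> y \<in> D \<Longrightarrow> x * y \<in> D"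
    using D(1) by (auto simp: is_subfield_def)
  show U'_eq: "?U' = {\<Sum>v\<in>U. scale (c v) v | c. range c \<subseteq> D}"
    by (rule span_over_finite[OF module_axioms finite_U D01(1)])
  show "F.subspace ?U'"
  proof (rule F.subspaceI)
    show "0 \<in> ?U'"
      using subset_span_over[OF module_axioms D01(2)] F.subspace_0[OF U] by blast
    show "x + y \<in> ?U'" if xy: "x \<in> ?U'" "y \<in> ?U'" for x y
    proof -
      obtain c c' where "x = (\<Sum>v\<in>U. scale (c v) v)" "range c \<subseteq> D"
          "y = (\<Sum>v\<in>U. scale (c' v) v)" "range c' \<subseteq> D"
        using xy unfolding U'_eq by blast
      then show ?thesis
        unfolding U'_eq using D(3)
        by (intro CollectI exI[of _ "\<lambda>v. c v + c' v"]) (auto simp: scale_left_distrib sum.distrib)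
    qed
    show "restrict_scalars emb scale a x \<in> ?U'" if x: "x \<in> ?U'" for a x
    proof -
      obtain c where "x = (\<Sum>v\<in>U. scale (c v) v)" "range c \<subseteq> D"
        using x unfolding U'_eq by blast
      then show ?thesis
        unfolding U'_eq using D_mult range_subsetD[OF D(2)]
        by (intro CollectI exI[of _ "\<lambda>v. emb a * c v"]) (auto simp: restrict_scalars_def scale_sum_right)
    qed
  qed
  show "finite ?U'"
  proof (rule finite_subset)
    show "?U' \<subseteq> (\<lambda>c. \<Sum>v\<in>U. scale (c v) v) ` (\<Pi>\<^sub>E v\<in>U. UNIV)"
    proof
      fix x assume "x \<in> ?U'"
      then obtain c where "x = (\<Sum>v\<in>U. scale (c v) v)"
        unfolding U'_eq by blast
      then show "x \<in> (\<lambda>c. \<Sum>v\<in>U. scale (c v) v) ` (\<Pi>\<^sub>E v\<in>U. UNIV)"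
        by (intro image_eqI[of _ _ "restrict c U"]) auto
    qed
    show "finite ((\<lambda>c. \<Sum>v\<in>U. scale (c v) v) ` (\<Pi>\<^sub>E v\<in>U. UNIV))"
      by (intro finite_imageI finite_PiE finite_U finite)
  qed
qed

text \<open>
  If the scalars that keep \<open>u\<close> in the extension of \<open>U'\<close> are spanned by \<open>Db\<close>, then this extension is
  spanned by \<open>ext U\<close> and the multiples of \<open>u\<close> by \<open>Db\<close>. The multiple by \<open>1\<close> is already in \<open>ext U\<close>,
  which makes the bound smaller than \<open>m + card Db\<close>.
\<close>

lemma dim_le_via_multipliers:
  assumes U': "U \<subseteq> U'" "finite U'" and u: "u \<in> ext U" and Db: "1 \<in> Db"
    and W: "ext U' \<subseteq> X.orbit_sum (ext U) u"
    and mult: "\<And>\<beta>. coordscale \<beta> u \<in> ext U' \<Longrightarrow> \<beta> \<in> X.L.span (fls_const ` Db)"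
  shows "F.dim U' \<le> m + card Db - 1"
proof -
  have U_W: "ext U \<subseteq> ext U'"
    unfolding ext_def using U' by (intro X.E.span_mono) auto
  obtain Ub where Ub: "F.independent Ub" "F.span Ub = U" "card Ub = m" "finite Ub"
    by (rule U_basis)
  define G where "G = \<Phi> ` Ub \<union> (\<lambda>\<delta>. coordscale (fls_const \<delta>) u) ` (Db - {1})"
  have "card G \<le> card (\<Phi> ` Ub) + card ((\<lambda>\<delta>. coordscale (fls_const \<delta>) u) ` (Db - {1}))"
    unfolding G_def by (rule card_Un_le)
  also have "\<dots> \<le> m + card (Db - {1})"
    using card_image_le[OF Ub(4), of \<Phi>] Ub(3) by (intro add_mono card_image_le) auto
  also have "\<dots> = m + card Db - 1"
  proof -
    have "0 < card Db" using Db by (auto simp: card_gt_0_iff)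
    then show ?thesis using Db by simp
  qed
  finally have cardG: "card G \<le> m + card Db - 1" .
  have U_G: "ext U \<subseteq> X.E.span G"
  proof -
    have "\<Phi> ` U \<subseteq> X.E.span G"
      using \<Phi>_span[of _ Ub] Ub(2) X.E.span_mono[of "\<Phi> ` Ub" G] by (auto simp: G_def)
    then show ?thesis
      unfolding ext_def by (rule X.E.span_minimal[OF _ X.E.subspace_span])
  qed
  have W_G: "ext U' \<subseteq> X.E.span G"
  proof
    fix x assume x: "x \<in> ext U'"
    then obtain y \<beta> where y: "x = y + coordscale \<beta> u" "y \<in> ext U"
      using W unfolding X.orbit_sum_def by blast
    then have "coordscale \<beta> u \<in> ext U'"
      using X.E.subspace_diff[OF subspace_ext x, of y] U_W by (auto simp: algebra_simps)
    then have "\<beta> \<in> X.L.span (fls_const ` Db)"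
      by (rule mult)
    then have "coordscale \<beta> u \<in> X.E.span ((\<lambda>x. coordscale x u) ` fls_const ` Db)"
      unfolding X.LE.linear_span_image[OF X.linear_orbit] by blast
    moreover have "(\<lambda>x. coordscale x u) ` fls_const ` Db \<subseteq> X.E.span G"
    proof clarify
      fix \<delta> assume \<delta>: "\<delta> \<in> Db"
      show "coordscale (fls_const \<delta>) u \<in> X.E.span G"
      proof (cases "\<delta> = 1")
        case True
        then show ?thesis using U_G u by (auto simp: constD)
      next
        case False
        then show ?thesis using \<delta> by (intro X.E.span_base) (auto simp: G_def)
      qed
    qed
    ultimately have "coordscale \<beta> u \<in> X.E.span G"
      using X.E.span_minimal[OF _ X.E.subspace_span] by blast
    then show "x \<in> X.E.span G"
      using y U_G X.E.span_add by blast
  qed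
  obtain C where C: "C \<subseteq> U'" "F.independent C" "card C = F.dim U'"
    using F.basis_exists by metis
  have "finite C" using C(1) U'(2) finite_subset by blast
  have "card (\<Phi> ` C) \<le> card G"
  proof (rule X.E.independent_span_bound[THEN conjunct2])
    show "X.E.independent (\<Phi> ` C)" by (rule \<Phi>_independent) fact+
    show "\<Phi> ` C \<subseteq> X.E.span G" using C(1) W_G in_ext by blast
    show "finite G" using Ub(4) by (simp add: G_def)
  qed
  then show ?thesis
    using C(3) cardG by (simp add: card_image inj_on_subset[OF inj_\<Phi> subset_UNIV])
qed

lemma exists_field_of_linearity:
  obtains D d where "w \<le> d" "is_subfield D" "card D = CARD('a) ^ d"
    "F.subspace (span_over scale D U)" "F.dim (span_over scale D U) \<le> m + d - 1"
    "finite (span_over scale D U)"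
proof -
  let ?S = "\<lambda>D. span_over scale D U"
  \<comment> \<open>the subfield \<open>D\<close> depends on \<open>u\<close>, so \<open>u\<close> is made generic for all candidates at once\<close>
  have "\<exists>u\<in>ext U. \<forall>W\<in>insert (ext U) (range (\<lambda>D. ext (?S D))). X.generic (ext U) W u"
    by (rule X.exists_simultaneously_generic[OF infinite_UNIV_fls _ subspace_ext])
       (auto intro: card_independent_le_n subspace_ext)
  then obtain u where u: "u \<in> ext U" and gen0: "X.generic (ext U) (ext U) u"
      and gen: "\<And>D. X.generic (ext U) (ext (?S D)) u"
    by auto
  define M where "M = X.orbit_sum (ext U) u"
  define B where "B = X.stabiliser M"
  have M_sub: "X.E.subspace M"
    unfolding M_def by (rule X.subspace_orbit_sum[OF subspace_ext])
  note B = X.stabiliser_ring[OF M_sub, folded B_def]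
  have multiplier: "\<alpha> \<in> B"
    if "X.E.subspace W" "W \<subseteq> M" "X.generic (ext U) W u" "coordscale \<alpha> u \<in> W" for \<alpha> W
    using X.multiplier_of_generic_in_stabiliser[OF infinite_UNIV_fls subspace_ext] that
    by (simp add: B_def M_def)
  define D where "D = {\<kappa>. fls_const \<kappa> \<in> B}"
  note D = constants_subfield[OF B, folded D_def]
  obtain Db where Db: "1 \<in> Db" "card D = CARD('a) ^ card Db" "B \<subseteq> X.L.span (fls_const ` Db)"
    using constants_basis[OF B, folded D_def] by blast

  have "w \<le> card (fls_const ` Db)"
  proof (rule weight_le_card_multipliers[OF u gen0])
    show "\<alpha> \<in> X.L.span (fls_const ` Db)" if "coordscale \<alpha> u \<in> ext U" for \<alpha>
      using multiplier[OF subspace_ext _ gen0 that] X.subset_orbit_sum Db(3) by (auto simp: M_def)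
  qed simp
  then have "w \<le> card Db"
    using card_image_le[of Db fls_const] by simp

  have W_M: "ext (?S D) \<subseteq> M"
    unfolding ext_def
  proof (rule X.E.span_minimal[OF _ M_sub], clarify)
    fix v assume "v \<in> ?S D"
    then have "v \<in> {\<Sum>v\<in>U. scale (c v) v | c. range c \<subseteq> D}"
      using span_over_subspace_finite(3)[OF D] by simp
    then obtain c where c: "v = (\<Sum>v\<in>U. scale (c v) v)" "range c \<subseteq> D"
      by blast
    have "coordscale (fls_const (c v)) (\<Phi> v) \<in> M" if "v \<in> U" for v
    proof -
      have "fls_const (c v) \<in> B" using c(2) by (auto simp: D_def)
      moreover have "\<Phi> v \<in> M" using in_ext[OF that] X.subset_orbit_sum by (auto simp: M_def)
      ultimately show ?thesis by (simp add: B_def X.stabiliser_def)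
    qed
    then show "\<Phi> v \<in> M"
      unfolding c(1) \<Phi>_sum \<Phi>_scale by (intro X.E.subspace_sum[OF M_sub])
  qed
  have "F.dim (?S D) \<le> m + card Db - 1"
  proof (rule dim_le_via_multipliers[OF _ span_over_subspace_finite(2)[OF D] u Db(1)])
    show "U \<subseteq> ?S D"
      using D(1) by (intro subset_span_over module_axioms) (simp add: is_subfield_def)
    show "ext (?S D) \<subseteq> X.orbit_sum (ext U) u" using W_M by (simp add: M_def)
    show "\<beta> \<in> X.L.span (fls_const ` Db)" if "coordscale \<beta> u \<in> ext (?S D)" for \<beta>
      using multiplier[OF subspace_ext W_M gen that] Db(3) by blast
  qed
  then show thesis
    using that[OF \<open>w \<le> card Db\<close> D(1) Db(2)] span_over_subspace_finite[OF D] by blast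
qed

text \<open>
  For \<open>y \<in> U'\<close> the map \<open>\<delta> \<mapsto> \<delta> y\<close> from \<open>D\<close>, of dimension \<open>d\<close>, to the quotient of \<open>U'\<close> by \<open>U\<close>, of
  dimension less than \<open>d\<close>, cannot be injective. So every point of \<open>U'\<close> is a point of \<open>U\<close>.
\<close>

lemma linear_set_eq:
  obtains D d where "w \<le> d" "d dvd n" "is_subfield D" "card D = CARD('a) ^ d"
    "linear_set scale U = linear_set scale (span_over scale D U)"
proof -
  obtain D d where D: "w \<le> d" "is_subfield D" "card D = CARD('a) ^ d"
    and sub: "F.subspace (span_over scale D U)" and dim: "F.dim (span_over scale D U) \<le> m + d - 1"
    and fin: "finite (span_over scale D U)"
    by (rule exists_field_of_linearity)
  let ?U' = "span_over scale D U"
  have D01: "0 \<in> D" "1 \<in> D" "\<And>x y. x \<in> D \<Longrightarrow> y \<in> D \<Longrightarrow> x - y \<in> D"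
    and D_mult: "\<And>x y. x \<in> D \<Longrightarrow> y \<in> D \<Longrightarrow> x * y \<in> D"
    using D(2) by (auto simp: is_subfield_def)
  have U_U': "U \<subseteq> ?U'"
    by (rule subset_span_over[OF module_axioms D01(2)])
  have D_scale: "scale \<delta> y \<in> ?U'" if \<delta>y: "\<delta> \<in> D" "y \<in> ?U'" for \<delta> y
  proof -
    obtain T c where "y = (\<Sum>v\<in>T. scale (c v) v)" "finite T" "T \<subseteq> U" "c ` T \<subseteq> D"
      using \<delta>y(2) unfolding span_over_def by blast
    then show ?thesis
      unfolding span_over_def using \<delta>y(1) D_mult
      by (intro CollectI exI[of _ T] exI[of _ "\<lambda>v. \<delta> * c v"]) (auto simp: scale_sum_right)
  qed
  have key: "\<exists>\<delta>\<in>D. \<delta> \<noteq> 0 \<and> scale \<delta> y \<in> U" if y: "y \<in> ?U'" for y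
  proof (rule ccontr)
    assume no: "\<not> ?thesis"
    have "inj_on (\<lambda>(\<delta>, x). scale \<delta> y + x) (D \<times> U)"
    proof (rule inj_onI, clarify)
      fix \<delta> \<delta>' x x' assume *: "\<delta> \<in> D" "\<delta>' \<in> D" "x \<in> U" "x' \<in> U" "scale \<delta> y + x = scale \<delta>' y + x'"
      then have "scale (\<delta> - \<delta>') y = x' - x"
        by (simp add: scale_left_diff_distrib algebra_simps)
      then have "scale (\<delta> - \<delta>') y \<in> U"
        using * F.subspace_diff[OF U] by simp
      then have "\<delta> = \<delta>'"
        using no D01(3) * by (metis right_minus_eq)
      then show "\<delta> = \<delta>' \<and> x = x'" using * by simp
    qed
    moreover have "(\<lambda>(\<delta>, x). scale \<delta> y + x) ` (D \<times> U) \<subseteq> ?U'"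
      using D_scale[OF _ y] U_U' F.subspace_add[OF sub] by auto
    ultimately have "card (D \<times> U) \<le> card ?U'"
      using fin by (metis card_image card_mono)
    moreover have "card ?U' = CARD('a) ^ F.dim ?U'"
    proof -
      obtain C where C: "C \<subseteq> ?U'" "F.independent C" "?U' \<subseteq> F.span C" "card C = F.dim ?U'"
        using F.basis_exists by metis
      then have "F.span C = ?U'" using sub by (metis F.span_minimal subset_antisym)
      then show ?thesis
        using F.card_span_independent[of C] C fin finite_subset by fastforce
    qed
    ultimately have "CARD('a) ^ (d + m) \<le> CARD('a) ^ F.dim ?U'"
      using D(3) card_U by (simp add: card_cartesian_product power_add)
    then have "d + m \<le> F.dim ?U'"
      using two_le_q by (simp add: power_increasing_iff)
    then show False using dim m by simp
  qed
  have "linear_set scale ?U' \<subseteq> linear_set scale U"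
  proof
    fix P assume "P \<in> linear_set scale ?U'"
    then obtain y where y: "P = span {y}" "y \<in> ?U'" "y \<noteq> 0"
      by (auto simp: linear_set_def)
    obtain \<delta> where \<delta>: "\<delta> \<noteq> 0" "scale \<delta> y \<in> U" using key[OF y(2)] by blast
    have "span {scale \<delta> y} = span {y}"
    proof (intro equalityI span_minimal)
      have "y = scale (inverse \<delta>) (scale \<delta> y)" using \<delta>(1) by simp
      then show "{y} \<subseteq> span {scale \<delta> y}"
        by (metis empty_subsetI insert_subset span_base span_scale singletonI)
    qed (auto intro: span_scale span_base)
    then show "P \<in> linear_set scale U"
      using y \<delta> unfolding linear_set_def by (auto intro!: exI[of _ "scale \<delta> y"])
  qed
  moreover have "linear_set scale U \<subseteq> linear_set scale ?U'"
    using U_U' by (auto simp: linear_set_def)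
  moreover have "d dvd n"
    by (rule subfield_degree_dvd[OF D(2,3) cardK two_le_q])
  ultimately show thesis using that D by blast
qed

end

theorem theorem2:
  fixes emb :: "'a::{field,finite} \<Rightarrow> 'k::{field,finite}"
    and scale :: "'k \<Rightarrow> 'v::ab_group_add \<Rightarrow> 'v"
    and U :: "'v set"
    and q n r m w :: nat
  assumes "primepow q" and "n \<ge> 1" and "r \<ge> 2"
    and "CARD('a) = q" and "CARD('k) = q ^ n" and "field_embedding emb"
    and "vector_space scale" and "vector_space.dim scale (UNIV :: 'v set) = r"
    and "module.subspace (restrict_scalars emb scale) U"
    and "vector_space.dim (restrict_scalars emb scale) U = m"
    and "1 \<le> m" and "m \<le> (r - 1) * n"
    and "n \<le> q"
    and "w \<ge> 2"
    and "\<forall>P\<in>linear_set scale U. point_weight emb scale U P \<ge> w"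
  shows "\<exists>d K. d \<ge> w \<and> d dvd n \<and> is_subfield K \<and> card K = q ^ d \<and>
           linear_set scale U = linear_set scale (span_over scale K U)"
proof -
  interpret V: vector_space scale by fact
  obtain Bs where "V.independent Bs" "V.span Bs = UNIV"
    using V.maximal_independent_subset[of UNIV] by (metis top.extremum_unique)
  then interpret linear_set_setting scale emb Bs U n m w
    using assms by unfold_locales auto
  show ?thesis
    using linear_set_eq assms(4) by metis
qed

end
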